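(* Let $k$ be a positive integer and $c>0$. The vector $\vec{x}(c)=(x_1(c),\ldots,x_m(c))\in D$, where $x_j(c)=\Pr[EV[T_c]=j]$ is the probability that the Galton-Watson tree $T_c$ with Poisson($c$) offspring lies in the $k$-Ehrenfeucht class $j$, is a fixed point of the map $\Psi_c:D\to D$. That is, $\Psi_c(\vec{x}(c))=\vec{x}(c)$.
   Context: $T_c$ is the random rooted tree in which each node, independently, has a Poisson($c$) number of children. The first order language of rooted trees has a constant symbol $R$ (the root), equality, and the parent relation $\pi[v]=w$ ("$w$ is the parent of $v$"); sentences are finite, with Boolean connectives and quantification over vertices, and the quantifier depth of a sentence is the depth of nesting of its quantifiers. Fix a positive integer $k$. For rooted trees (finite or infinite), $T\equiv_k T'$ means that $T,T'$ have the same truth value for all first order sentences of quantifier depth at most $k$ (equivalently, Duplicator wins the $k$-move Ehrenfeucht game on $T,T'$). The set $\Sigma=\Sigma_k$ of equivalence classes is finite; write $\Sigma=\{1,\ldots,m\}$. $EV[T]\in\Sigma$ denotes the class of $T$. $D=\{(x_1,\ldots,x_m)\in\mathbb{R}^m:\sum_j x_j=1,\ x_j\ge 0\}$ is the set of probability distributions on $\Sigma$. Let $C=\{0,1,\ldots,k-1,\omega\}$, where a count of $\omega$ means "at least $k$" and a count $n\ne\omega$ means exactly $n$. $T(v)$ denotes the rooted tree consisting of $v$ and all its descendants, with root $v$. A rootchild is a child of the root. The recursion function $\Gamma:C^m\to\Sigma$ is given by: $\Gamma(n_1,\ldots,n_m)$ is the class $EV[T]$ of any rooted tree $T$ which for each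 $j$ has $n_j$ rootchildren $v$ with $EV[T(v)]=j$ (this class depends only on $(n_1,\ldots,n_m)$). $\Psi_c:D\to D$ is defined as follows: give a root a Poisson($c$) number of children, assign each child independently a label in $\Sigma$ with distribution $\vec{x}$, and let $n_j\in C$ be the number of children with label $j$ (with $\omega$ recorded when there are at least $k$); $\Psi_c(\vec{x})$ is the distribution of $\Gamma(n_1,\ldots,n_m)$. Equivalently, the $j$-th coordinate of $\Psi_c(\vec{x})$ is $\sum_{\vec{a}\in C^m:\Gamma(\vec{a})=j}\prod_{i=1}^m p_i(a_i)$, where $p_i(u)=e^{-cx_i}(cx_i)^u/u!$ for $u\in\{0,\ldots,k-1\}$ and $p_i(\omega)=1-\sum_{u=0}^{k-1}p_i(u)$. *)

theory Defs
  imports "HOL-Probability.Probability"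
begin

section \<open>Rooted trees\<close>

text \<open>
  A rooted tree is given by its vertex set, its root, and its parent relation:
  \<open>(v, w) \<in> par T\<close> means that \<open>w\<close> is the parent of \<open>v\<close>.
\<close>

record 'a rtree =
  verts :: "'a set"
  troot :: 'a
  par :: "'a rel"

definition rooted_tree :: "'a rtree \<Rightarrow> bool" where
  "rooted_tree T \<longleftrightarrow>
     troot T \<in> verts T \<and>
     par T \<subseteq> verts T \<times> verts T \<and>
     (\<nexists>w. (troot T, w) \<in> par T) \<and>
     (\<forall>v \<in> verts T - {troot T}. \<exists>!w. (v, w) \<in> par T) \<and>
     (\<forall>v \<in> verts T. (v, troot T) \<in> (par T)\<^sup>*)"

definition rootchildren :: "'a rtree \<Rightarrow> 'a set" where
  "rootchildren T = {v. (v, troot T) \<in> par T}"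

definition descendants :: "'a rtree \<Rightarrow> 'a \<Rightarrow> 'a set" where
  "descendants T v = {u \<in> verts T. (u, v) \<in> (par T)\<^sup>*}"

text \<open>The tree \<open>T(v)\<close> consisting of \<open>v\<close> and all its descendants, with root \<open>v\<close>.\<close>

definition subtree :: "'a rtree \<Rightarrow> 'a \<Rightarrow> 'a rtree" where
  "subtree T v = \<lparr>verts = descendants T v, troot = v,
                  par = par T \<inter> (descendants T v \<times> descendants T v)\<rparr>"


section \<open>The first order language of rooted trees\<close>

datatype trm = Var nat | Root

datatype form =
    Eq trm trm
  | Parent trm trm  \<comment> \<open>\<open>Parent s t\<close> is the atomic formula \<open>\<pi>[s] = t\<close>\<close>
  | Neg form
  | Conj form form
  | Disj form form
  | Exists nat form
  | Forall nat form

fun trm_vars :: "trm \<Rightarrow> nat set" where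
  "trm_vars (Var x) = {x}"
| "trm_vars Root = {}"

fun free_vars :: "form \<Rightarrow> nat set" where
  "free_vars (Eq s t) = trm_vars s \<union> trm_vars t"
| "free_vars (Parent s t) = trm_vars s \<union> trm_vars t"
| "free_vars (Neg \<phi>) = free_vars \<phi>"
| "free_vars (Conj \<phi> \<psi>) = free_vars \<phi> \<union> free_vars \<psi>"
| "free_vars (Disj \<phi> \<psi>) = free_vars \<phi> \<union> free_vars \<psi>"
| "free_vars (Exists x \<phi>) = free_vars \<phi> - {x}"
| "free_vars (Forall x \<phi>) = free_vars \<phi> - {x}"

definition sentence :: "form \<Rightarrow> bool" where
  "sentence \<phi> \<longleftrightarrow> free_vars \<phi> = {}"

fun qdepth :: "form \<Rightarrow> nat" where
  "qdepth (Eq s t) = 0"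
| "qdepth (Parent s t) = 0"
| "qdepth (Neg \<phi>) = qdepth \<phi>"
| "qdepth (Conj \<phi> \<psi>) = max (qdepth \<phi>) (qdepth \<psi>)"
| "qdepth (Disj \<phi> \<psi>) = max (qdepth \<phi>) (qdepth \<psi>)"
| "qdepth (Exists x \<phi>) = Suc (qdepth \<phi>)"
| "qdepth (Forall x \<phi>) = Suc (qdepth \<phi>)"

fun trm_val :: "'a rtree \<Rightarrow> (nat \<Rightarrow> 'a) \<Rightarrow> trm \<Rightarrow> 'a" where
  "trm_val T e (Var x) = e x"
| "trm_val T e Root = troot T"

fun sat :: "'a rtree \<Rightarrow> (nat \<Rightarrow> 'a) \<Rightarrow> form \<Rightarrow> bool" where
  "sat T e (Eq s t) \<longleftrightarrow> trm_val T e s = trm_val T e t"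
| "sat T e (Parent s t) \<longleftrightarrow> (trm_val T e s, trm_val T e t) \<in> par T"
| "sat T e (Neg \<phi>) \<longleftrightarrow> \<not> sat T e \<phi>"
| "sat T e (Conj \<phi> \<psi>) \<longleftrightarrow> sat T e \<phi> \<and> sat T e \<psi>"
| "sat T e (Disj \<phi> \<psi>) \<longleftrightarrow> sat T e \<phi> \<or> sat T e \<psi>"
| "sat T e (Exists x \<phi>) \<longleftrightarrow> (\<exists>v \<in> verts T. sat T (e(x := v)) \<phi>)"
| "sat T e (Forall x \<phi>) \<longleftrightarrow> (\<forall>v \<in> verts T. sat T (e(x := v)) \<phi>)"

text \<open>The truth value of a sentence does not depend on the assignment, so we fix one.\<close>

definition models :: "'a rtree \<Rightarrow> form \<Rightarrow> bool" where
  "models T \<phi> \<longleftrightarrow> sat T (\<lambda>_. troot T) \<phi>"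


section \<open>Ehrenfeucht classes\<close>

definition equiv_upto :: "nat \<Rightarrow> 'a rtree \<Rightarrow> 'b rtree \<Rightarrow> bool" where
  "equiv_upto k T T' \<longleftrightarrow> (\<forall>\<phi>. sentence \<phi> \<and> qdepth \<phi> \<le> k \<longrightarrow> models T \<phi> = models T' \<phi>)"

text \<open>
  The equivalence classes are formed over the trees whose vertices are taken from the countably
  infinite type \<open>nat list\<close>. No class is lost: by the downward Loewenheim-Skolem theorem every rooted
  tree, whatever its vertex type, is equivalent to one of these (\<open>EV_in_Sig\<close> below).
\<close>

type_synonym ctree = "nat list rtree"
type_synonym eclass = "ctree set"

definition Sig :: "nat \<Rightarrow> eclass set" where
  "Sig k = {T. rooted_tree T} // {(T, T'). rooted_tree T \<and> rooted_tree T' \<and> equiv_upto k T T'}"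

definition EV :: "nat \<Rightarrow> 'a rtree \<Rightarrow> eclass" where
  "EV k T = {S. rooted_tree S \<and> equiv_upto k T S}"

text \<open>Vectors indexed by \<open>\<Sigma>\<close> are functions that are \<open>undefined\<close> outside \<open>\<Sigma>\<close>.\<close>

definition Distr :: "nat \<Rightarrow> (eclass \<Rightarrow> real) set" where
  "Distr k = {x \<in> extensional (Sig k). (\<forall>j \<in> Sig k. x j \<ge> 0) \<and> (\<Sum>j \<in> Sig k. x j) = 1}"


section \<open>The recursion function\<close>

text \<open>
  The set \<open>C = {0, \<dots>, k - 1, \<omega>}\<close>: \<open>Exactly n\<close> is only used for \<open>n < k\<close>, and \<open>Omega\<close> records
  ``at least \<open>k\<close>'' (including infinitely many).
\<close>

datatype tally = Exactly nat | Omega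

definition tally_of :: "nat \<Rightarrow> 'b set \<Rightarrow> tally" where
  "tally_of k A = (if finite A \<and> card A < k then Exactly (card A) else Omega)"

definition child_tallies :: "nat \<Rightarrow> 'a rtree \<Rightarrow> eclass \<Rightarrow> tally" where
  "child_tallies k T = (\<lambda>j \<in> Sig k. tally_of k {v \<in> rootchildren T. EV k (subtree T v) = j})"

definition Gam :: "nat \<Rightarrow> (eclass \<Rightarrow> tally) \<Rightarrow> eclass" where
  "Gam k n = (THE j. \<exists>T :: ctree. rooted_tree T \<and> child_tallies k T = n \<and> EV k T = j)"


section \<open>The map on distributions\<close>

text \<open>Only meaningful for \<open>x \<in> Distr k\<close>: otherwise \<open>embed_pmf\<close> is unspecified.\<close>

definition label_pmf :: "nat \<Rightarrow> (eclass \<Rightarrow> real) \<Rightarrow> eclass pmf" where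
  "label_pmf k x = embed_pmf (\<lambda>j. if j \<in> Sig k then x j else 0)"

text \<open>
  The root has \<open>N\<close> children \<open>0, \<dots>, N - 1\<close>, and child \<open>i\<close> receives the label \<open>l i\<close>.
\<close>

definition Psi_pmf :: "nat \<Rightarrow> real \<Rightarrow> (eclass \<Rightarrow> real) \<Rightarrow> eclass pmf" where
  "Psi_pmf k c x =
     do {
       N \<leftarrow> poisson_pmf c;
       l \<leftarrow> Pi_pmf {..<N} undefined (\<lambda>_. label_pmf k x);
       return_pmf (Gam k (\<lambda>j \<in> Sig k. tally_of k {i \<in> {..<N}. l i = j}))
     }"

definition Psi :: "nat \<Rightarrow> real \<Rightarrow> (eclass \<Rightarrow> real) \<Rightarrow> (eclass \<Rightarrow> real)" where
  "Psi k c x = (\<lambda>j \<in> Sig k. pmf (Psi_pmf k c x) j)"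


section \<open>The Galton-Watson tree\<close>

text \<open>
  Potential vertices are finite sequences of naturals; the children of \<open>u\<close> are
  \<open>u @ [0], \<dots>, u @ [\<omega> u - 1]\<close>, where the numbers \<open>\<omega> u\<close> are independent and Poisson distributed.
\<close>

definition GW :: "real \<Rightarrow> (nat list \<Rightarrow> nat) measure" where
  "GW c = (\<Pi>\<^sub>M u \<in> UNIV. measure_pmf (poisson_pmf c))"

inductive_set gw_verts :: "(nat list \<Rightarrow> nat) \<Rightarrow> nat list set" for \<omega> :: "nat list \<Rightarrow> nat" where
  gw_root: "[] \<in> gw_verts \<omega>"
| gw_child: "u \<in> gw_verts \<omega> \<Longrightarrow> i < \<omega> u \<Longrightarrow> u @ [i] \<in> gw_verts \<omega>"

definition gw_tree :: "(nat list \<Rightarrow> nat) \<Rightarrow> ctree" where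
  "gw_tree \<omega> = \<lparr>verts = gw_verts \<omega>, troot = [],
                par = {(u @ [i], u) | u i. u \<in> gw_verts \<omega> \<and> i < \<omega> u}\<rparr>"

definition gw_class_probs :: "nat \<Rightarrow> real \<Rightarrow> (eclass \<Rightarrow> real)" where
  "gw_class_probs k c = (\<lambda>j \<in> Sig k. \<P>(\<omega> in GW c. EV k (gw_tree \<omega>) = j))"


section \<open>Well-definedness\<close>

text \<open>
  Every rooted tree has its class in \<open>Sig k\<close>, equality of classes is \<open>equiv_upto\<close>, and the events
  defining \<open>gw_class_probs\<close> are measurable, so that the values of \<open>\<P>\<close> are not vacuously zero.
\<close>

lemma trm_val_cong: "\<forall>x\<in>trm_vars t. e x = e' x \<Longrightarrow> trm_val T e t = trm_val T e' t"
  by (cases t) auto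

lemma sat_cong: "\<forall>x\<in>free_vars \<phi>. e x = e' x \<Longrightarrow> sat T e \<phi> = sat T e' \<phi>"
proof (induction \<phi> arbitrary: e e')
  case (Eq s t)
  then show ?case using trm_val_cong[of s e e' T] trm_val_cong[of t e e' T] by auto
next
  case (Parent s t)
  then show ?case using trm_val_cong[of s e e' T] trm_val_cong[of t e e' T] by auto
next
  case (Neg \<phi>)
  then show ?case by (metis sat.simps(3) free_vars.simps(3))
next
  case (Conj \<phi> \<psi>)
  then have "sat T e \<phi> = sat T e' \<phi>" "sat T e \<psi> = sat T e' \<psi>" by auto
  then show ?case by simp
next
  case (Disj \<phi> \<psi>)
  then have "sat T e \<phi> = sat T e' \<phi>" "sat T e \<psi> = sat T e' \<psi>" by auto
  then show ?case by simp
next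
  case (Exists x \<phi>)
  have "sat T (e(x := v)) \<phi> = sat T (e'(x := v)) \<phi>" for v
    using Exists.prems by (intro Exists.IH) auto
  then show ?case by simp
next
  case (Forall x \<phi>)
  have "sat T (e(x := v)) \<phi> = sat T (e'(x := v)) \<phi>" for v
    using Forall.prems by (intro Forall.IH) auto
  then show ?case by simp
qed

lemma finite_free_vars: "finite (free_vars \<phi>)"
proof -
  have "finite (trm_vars t)" for t by (cases t) auto
  then show ?thesis by (induction \<phi>) auto
qed

definition map_rtree :: "('a \<Rightarrow> 'b) \<Rightarrow> 'a rtree \<Rightarrow> 'b rtree" where
  "map_rtree f T = \<lparr>verts = f ` verts T, troot = f (troot T), par = map_prod f f ` par T\<rparr>"

lemma trm_val_map: "trm_val (map_rtree f T) (f \<circ> e) t = f (trm_val T e t)"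
  by (cases t) (auto simp: map_rtree_def)

lemma trm_val_in: "range e \<subseteq> verts T \<Longrightarrow> troot T \<in> verts T \<Longrightarrow> trm_val T e t \<in> verts T"
  by (cases t) auto

lemma map_rtree_par_iff:
  assumes "rooted_tree T" "inj_on f (verts T)" "a \<in> verts T"
  shows "(f a, y) \<in> map_prod f f ` par T \<longleftrightarrow> (\<exists>b. (a, b) \<in> par T \<and> y = f b)"
proof
  assume "(f a, y) \<in> map_prod f f ` par T"
  then obtain a' b where *: "(a', b) \<in> par T" "f a = f a'" "y = f b" by auto
  then have "a' \<in> verts T" using assms(1) by (auto simp: rooted_tree_def)
  then have "a = a'" using inj_onD[OF assms(2) *(2) assms(3)] by simp
  then show "\<exists>b. (a, b) \<in> par T \<and> y = f b" using * by blast
qed force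

lemma sat_map_rtree:
  assumes T: "rooted_tree T" and f: "inj_on f (verts T)" and e: "range e \<subseteq> verts T"
  shows "sat (map_rtree f T) (f \<circ> e) \<phi> = sat T e \<phi>"
  using e
proof (induction \<phi> arbitrary: e)
  have r: "troot T \<in> verts T" and p: "par T \<subseteq> verts T \<times> verts T"
    using T by (auto simp: rooted_tree_def)
  {
    case (Eq s t)
    then show ?case
      using inj_on_eq_iff[OF f trm_val_in[OF Eq r] trm_val_in[OF Eq r]]
      by (simp add: trm_val_map del: o_apply)
  next
    case (Parent s t)
    have "(f a, f b) \<in> map_prod f f ` par T \<longleftrightarrow> (a, b) \<in> par T"
      if "a \<in> verts T" "b \<in> verts T" for a b
      using map_rtree_par_iff[OF T f that(1)] inj_on_eq_iff[OF f that(2)] p by auto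
    then show ?case
      using trm_val_in[OF Parent r] by (simp add: trm_val_map del: o_apply) (simp add: map_rtree_def)
  next
    case (Exists x \<phi>)
    have "sat (map_rtree f T) ((f \<circ> e)(x := f v)) \<phi> = sat T (e(x := v)) \<phi>" if "v \<in> verts T" for v
    proof -
      have "range (e(x := v)) \<subseteq> verts T" using Exists.prems that by auto
      then show ?thesis using Exists.IH[of "e(x := v)"] by (simp only: fun_upd_comp)
    qed
    moreover have "verts (map_rtree f T) = f ` verts T" by (simp add: map_rtree_def)
    ultimately show ?case by (simp del: o_apply)
  next
    case (Forall x \<phi>)
    have "sat (map_rtree f T) ((f \<circ> e)(x := f v)) \<phi> = sat T (e(x := v)) \<phi>" if "v \<in> verts T" for v
    proof -
      have "range (e(x := v)) \<subseteq> verts T" using Forall.prems that by auto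
      then show ?thesis using Forall.IH[of "e(x := v)"] by (simp only: fun_upd_comp)
    qed
    moreover have "verts (map_rtree f T) = f ` verts T" by (simp add: map_rtree_def)
    ultimately show ?case by (simp del: o_apply)
  }
qed auto

lemma rooted_tree_map_rtree:
  assumes T: "rooted_tree T" and f: "inj_on f (verts T)"
  shows "rooted_tree (map_rtree f T)"
proof -
  have r: "troot T \<in> verts T" and p: "par T \<subseteq> verts T \<times> verts T"
    and nr: "\<nexists>w. (troot T, w) \<in> par T"
    and un: "\<And>v. v \<in> verts T - {troot T} \<Longrightarrow> \<exists>!w. (v, w) \<in> par T"
    and rch: "\<And>v. v \<in> verts T \<Longrightarrow> (v, troot T) \<in> (par T)\<^sup>*"
    using T by (auto simp: rooted_tree_def)
  have mem: "(f a, y) \<in> map_prod f f ` par T \<longleftrightarrow> (\<exists>b. (a, b) \<in> par T \<and> y = f b)"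
    if "a \<in> verts T" for a y
    by (rule map_rtree_par_iff[OF T f that])
  have path: "(f a, f b) \<in> (map_prod f f ` par T)\<^sup>*" if "(a, b) \<in> (par T)\<^sup>*" for a b
    using that
  proof induction
    case (step y z)
    then have "(f y, f z) \<in> map_prod f f ` par T" by force
    then show ?case using step.IH by (rule rtrancl_into_rtrancl[rotated])
  qed simp
  have unf: "\<exists>!w. (f v, w) \<in> map_prod f f ` par T" if "v \<in> verts T" "f v \<noteq> f (troot T)" for v
  proof -
    have "v \<in> verts T - {troot T}" using that by blast
    then have ex: "\<exists>!w. (v, w) \<in> par T" by (rule un)
    define w where "w = (THE w. (v, w) \<in> par T)"
    have w: "(v, w) \<in> par T"
      unfolding w_def by (rule theI'[OF ex])
    have w_unique: "w' = w" if "(v, w') \<in> par T" for w'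
      unfolding w_def by (rule the1_equality[OF ex that, symmetric])
    show ?thesis
    proof (rule ex1I[of _ "f w"])
      show "(f v, f w) \<in> map_prod f f ` par T"
        by (rule mem[OF that(1), THEN iffD2]) (use w in blast)
    next
      fix y assume "(f v, y) \<in> map_prod f f ` par T"
      then have "\<exists>b. (v, b) \<in> par T \<and> y = f b"
        by (rule mem[OF that(1), THEN iffD1])
      then obtain b where "(v, b) \<in> par T" "y = f b"
        by blast
      then show "y = f w" using w_unique[of b] by simp
    qed
  qed
  have "\<exists>!w. (v, w) \<in> map_prod f f ` par T" if v: "v \<in> f ` verts T - {f (troot T)}" for v
  proof -
    obtain u where u: "v = f u" "u \<in> verts T" using v by blast
    show ?thesis unfolding u(1) by (rule unf) (use u v in blast)+
  qed
  moreover have "\<nexists>w. (f (troot T), w) \<in> map_prod f f ` par T"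
    using nr mem[OF r] by simp
  moreover have "map_prod f f ` par T \<subseteq> f ` verts T \<times> f ` verts T"
    using p by auto
  moreover have "\<forall>v \<in> f ` verts T. (v, f (troot T)) \<in> (map_prod f f ` par T)\<^sup>*"
    using path rch by blast
  moreover have "f (troot T) \<in> f ` verts T"
    using r by (rule imageI)
  ultimately show ?thesis
    unfolding rooted_tree_def map_rtree_def rtree.simps by (intro conjI ballI) (erule bspec | assumption)+
qed

lemma models_map_rtree:
  assumes "rooted_tree T" "inj_on f (verts T)"
  shows "models (map_rtree f T) \<phi> = models T \<phi>"
proof -
  have "sat (map_rtree f T) (f \<circ> (\<lambda>_. troot T)) \<phi> = sat T (\<lambda>_. troot T) \<phi>"
    using assms by (intro sat_map_rtree) (auto simp: rooted_tree_def)
  then show ?thesis by (simp add: models_def comp_def) (simp add: map_rtree_def)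
qed

instance trm :: countable by countable_datatype
instance form :: countable by countable_datatype

lemma countable_elementary_subtree:
  assumes T: "rooted_tree T"
  obtains W where "countable W" "W \<subseteq> verts T"
    "rooted_tree \<lparr>verts = W, troot = troot T, par = par T \<inter> W \<times> W\<rparr>"
    "\<And>\<phi>. models \<lparr>verts = W, troot = troot T, par = par T \<inter> W \<times> W\<rparr> \<phi> = models T \<phi>"
proof -
  have r: "troot T \<in> verts T" and p: "par T \<subseteq> verts T \<times> verts T"
    and nr: "\<nexists>w. (troot T, w) \<in> par T"
    and un: "\<And>v. v \<in> verts T - {troot T} \<Longrightarrow> \<exists>!w. (v, w) \<in> par T"
    and rch: "\<And>v. v \<in> verts T \<Longrightarrow> (v, troot T) \<in> (par T)\<^sup>*"
    using T by (auto simp: rooted_tree_def)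
  define env where "env es = (\<lambda>n. if n < length es then es ! n else troot T)" for es
  define wit where "wit = (\<lambda>(\<phi>, x, es).
    if \<exists>v\<in>verts T. sat T ((env es)(x := v)) \<phi>
    then SOME v. v \<in> verts T \<and> sat T ((env es)(x := v)) \<phi> else troot T)"
  have wit: "wit (\<phi>, x, es) \<in> verts T"
    "\<exists>v\<in>verts T. sat T ((env es)(x := v)) \<phi> \<Longrightarrow> sat T ((env es)(x := wit (\<phi>, x, es))) \<phi>" for \<phi> x es
    using r someI_ex[of "\<lambda>v. v \<in> verts T \<and> sat T ((env es)(x := v)) \<phi>"]
    by (auto simp: wit_def)
  define A where "A n = ((\<lambda>B. B \<union> wit ` (UNIV \<times> UNIV \<times> lists B)) ^^ n) {troot T}" for n
  define W where "W = (\<Union>n. A n)"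
  have A0: "A 0 = {troot T}" and AS: "A (Suc n) = A n \<union> wit ` (UNIV \<times> UNIV \<times> lists (A n))" for n
    by (simp_all add: A_def)
  have "countable (A n)" for n
    by (induction n) (simp_all add: A0 AS)
  then have cW: "countable W" by (simp add: W_def)
  have "A n \<subseteq> verts T" for n
    using r wit(1) by (induction n) (auto simp: A0 AS)
  then have WV: "W \<subseteq> verts T" by (auto simp: W_def)
  have rW: "troot T \<in> W" using A0 by (auto simp: W_def)
  have mono: "mono A" by (rule mono_iff_le_Suc[THEN iffD2]) (auto simp: AS)
  have lst: "\<exists>n. es \<in> lists (A n)" if "es \<in> lists W" for es
    using that
  proof (induction es)
    case (Cons a es)
    then obtain n m where "es \<in> lists (A n)" "a \<in> A m" by (auto simp: W_def)
    then have "a # es \<in> lists (A (max m n))"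
      using monoD[OF mono, of n "max m n"] monoD[OF mono, of m "max m n"] by auto
    then show ?case by blast
  qed auto
  have cl: "wit (\<phi>, x, es) \<in> W" if "es \<in> lists W" for \<phi> x es
    using lst[OF that] AS by (fastforce simp: W_def)
  have tv: "\<exists>v\<in>W. sat T (e(x := v)) \<phi>"
    if e: "range e \<subseteq> W" and ex: "\<exists>v\<in>verts T. sat T (e(x := v)) \<phi>" for e x \<phi>
  proof -
    obtain N where N: "\<forall>y\<in>free_vars \<phi>. y < N"
      using finite_free_vars[of \<phi>] finite_nat_set_iff_bounded by blast
    define es where "es = map e [0..<N]"
    have eq: "sat T (e(x := v)) \<phi> = sat T ((env es)(x := v)) \<phi>" for v
      by (rule sat_cong) (use N in \<open>auto simp: env_def es_def\<close>)
    have "es \<in> lists W" using e by (auto simp: es_def image_subset_iff)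
    then show ?thesis using cl[of es \<phi> x] wit(2)[of es x \<phi>] ex by (auto simp: eq)
  qed
  define S where "S = \<lparr>verts = W, troot = troot T, par = par T \<inter> W \<times> W\<rparr>"
  have tr: "trm_val S e t = trm_val T e t" for e t
    by (cases t) (auto simp: S_def)
  have el: "sat S e \<phi> = sat T e \<phi>" if "range e \<subseteq> W" for e \<phi>
    using that
  proof (induction \<phi> arbitrary: e)
    case (Eq s t)
    then show ?case by (simp add: tr)
  next
    case (Parent s t)
    have "trm_val S e u \<in> W" for u
      using trm_val_in[of e S u] Parent rW by (simp add: S_def)
    then show ?case by (simp add: tr) (simp add: S_def)
  next
    case (Exists x \<phi>)
    have "sat S (e(x := v)) \<phi> = sat T (e(x := v)) \<phi>" if "v \<in> W" for v
    proof -
      have "range (e(x := v)) \<subseteq> W" using Exists.prems that by auto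
      then show ?thesis by (rule Exists.IH)
    qed
    then show ?case
      using tv[OF Exists.prems, of x \<phi>] WV by (auto simp: S_def)
  next
    case (Forall x \<phi>)
    have "sat S (e(x := v)) \<phi> = sat T (e(x := v)) \<phi>" if "v \<in> W" for v
    proof -
      have "range (e(x := v)) \<subseteq> W" using Forall.prems that by auto
      then show ?thesis by (rule Forall.IH)
    qed
    then show ?case
      using tv[OF Forall.prems, of x "Neg \<phi>"] WV by (auto simp: S_def)
  qed auto
  have parW: "w \<in> W" if "v \<in> W" "(v, w) \<in> par T" for v w
  proof -
    have "\<exists>u\<in>W. sat T ((\<lambda>_. v)(0 := u)) (Parent (Var 1) (Var 0))"
      using that p by (intro tv) auto
    then obtain u where "u \<in> W" "(v, u) \<in> par T" by auto
    moreover have "u = w"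
      using un[of v] nr that calculation p by blast
    ultimately show ?thesis by simp
  qed
  have rchW: "(v, troot T) \<in> (par T \<inter> W \<times> W)\<^sup>*" if "v \<in> W" for v
    using rch[of v] that WV
  proof -
    have "(v, troot T) \<in> (par T)\<^sup>*" using rch that WV by auto
    then show ?thesis using that
    proof (induction rule: converse_rtrancl_induct)
      case (step y z)
      then show ?case using parW by (auto intro: converse_rtrancl_into_rtrancl)
    qed simp
  qed
  have "\<exists>!w. (v, w) \<in> par T \<inter> W \<times> W" if "v \<in> W" "v \<noteq> troot T" for v
  proof -
    have "\<exists>!w. (v, w) \<in> par T" using un[of v] that WV by blast
    then show ?thesis using that(1) parW[OF that(1)] by blast
  qed
  then have "rooted_tree S"
    using rW nr rchW by (auto simp: rooted_tree_def S_def)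
  moreover have "models S \<phi> = models T \<phi>" for \<phi>
    using el[of "\<lambda>_. troot T" \<phi>] rW by (auto simp: models_def S_def)
  ultimately show ?thesis
    using that[OF cW WV] by (simp add: S_def)
qed

lemma ex_equiv_ctree:
  assumes "rooted_tree T"
  shows "\<exists>S :: ctree. rooted_tree S \<and> (\<forall>\<phi>. models S \<phi> = models T \<phi>)"
proof (rule countable_elementary_subtree[OF assms])
  fix W
  let ?S = "\<lparr>verts = W, troot = troot T, par = par T \<inter> W \<times> W\<rparr>"
  assume W: "countable W" "rooted_tree ?S" "\<And>\<phi>. models ?S \<phi> = models T \<phi>"
  define f where "f v = [to_nat_on W v]" for v
  have f: "inj_on f (verts ?S)"
    using inj_on_to_nat_on[OF W(1)] by (simp add: f_def inj_on_def)
  have "rooted_tree (map_rtree f ?S)"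
    by (rule rooted_tree_map_rtree[OF W(2) f])
  moreover have "models (map_rtree f ?S) \<phi> = models T \<phi>" for \<phi>
    using models_map_rtree[OF W(2) f] W(3) by (rule trans)
  ultimately show ?thesis by blast
qed

lemma EV_in_Sig:
  assumes "rooted_tree T"
  shows "EV k T \<in> Sig k"
proof -
  obtain S :: ctree where S: "rooted_tree S" "\<forall>\<phi>. models S \<phi> = models T \<phi>"
    using ex_equiv_ctree[OF assms] by blast
  have "equiv_upto k T S' = equiv_upto k S S'" for S' :: ctree
    using S(2) by (simp add: equiv_upto_def)
  then have "EV k T = {(S, S'). rooted_tree S \<and> rooted_tree S' \<and> equiv_upto k S S'} `` {S}"
    using S(1) by (simp add: EV_def Image_def)
  also have "\<dots> \<in> Sig k"
    unfolding Sig_def by (rule quotientI) (simp add: S(1))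
  finally show ?thesis .
qed

lemma EV_eq_iff:
  assumes "rooted_tree T" "rooted_tree T'"
  shows "EV k T = EV k T' \<longleftrightarrow> equiv_upto k T T'"
proof
  obtain S :: ctree where S: "rooted_tree S" "\<forall>\<phi>. models S \<phi> = models T \<phi>"
    using ex_equiv_ctree[OF assms(1)] by blast
  assume "EV k T = EV k T'"
  moreover have "S \<in> EV k T" using S by (simp add: EV_def equiv_upto_def)
  ultimately have "equiv_upto k T' S" by (simp add: EV_def)
  then show "equiv_upto k T T'" using S(2) by (simp add: equiv_upto_def)
next
  assume "equiv_upto k T T'"
  then have "equiv_upto k T S \<longleftrightarrow> equiv_upto k T' S" for S :: ctree
    by (auto simp: equiv_upto_def)
  then show "EV k T = EV k T'" by (simp add: EV_def)
qed

lemma gw_verts_snoc_iff: "u @ [i] \<in> gw_verts \<omega> \<longleftrightarrow> u \<in> gw_verts \<omega> \<and> i < \<omega> u"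
  by (subst gw_verts.simps) auto

lemma rooted_tree_gw_tree: "rooted_tree (gw_tree \<omega>)"
proof -
  let ?p = "{(u @ [i], u) | u i. u \<in> gw_verts \<omega> \<and> i < \<omega> u}"
  have "(v, []) \<in> ?p\<^sup>*" if "v \<in> gw_verts \<omega>" for v
    using that
  proof induction
    case (gw_child u i)
    then have "(u @ [i], u) \<in> ?p" by blast
    then show ?case using gw_child by (meson converse_rtrancl_into_rtrancl)
  qed simp
  moreover have "\<exists>!w. (v, w) \<in> ?p" if "v \<in> gw_verts \<omega>" "v \<noteq> []" for v
    using that by (cases v rule: rev_cases) (auto simp: gw_verts_snoc_iff)
  ultimately show ?thesis
    by (auto simp: rooted_tree_def gw_tree_def intro: gw_verts.intros)
qed

lemma gw_verts_measurable: "Measurable.pred (GW c) (\<lambda>\<omega>. v \<in> gw_verts \<omega>)"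
proof (induction v rule: rev_induct)
  case Nil
  then show ?case by (simp add: gw_root)
next
  case (snoc i u)
  have m: "(\<lambda>\<omega>. \<omega> u) \<in> GW c \<rightarrow>\<^sub>M count_space UNIV"
    by (rule measurable_compose[of "\<lambda>\<omega>. \<omega> u" _ "measure_pmf (poisson_pmf c)" id, simplified])
      (auto simp: GW_def)
  have "Measurable.pred (GW c) (\<lambda>\<omega>. i < \<omega> u)"
    using measurable_compose[OF m, of "\<lambda>n. i < n" "count_space UNIV"] by simp
  then show ?case using snoc by (simp add: gw_verts_snoc_iff)
qed

lemma sat_gw_tree_measurable: "Measurable.pred (GW c) (\<lambda>\<omega>. sat (gw_tree \<omega>) e \<phi>)"
proof (induction \<phi> arbitrary: e)
  have tr: "trm_val (gw_tree \<omega>) e t = trm_val (gw_tree \<omega>') e t" for \<omega> \<omega>' e t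
    by (cases t) (auto simp: gw_tree_def)
  {
    case (Eq s t)
    define b where "b \<longleftrightarrow> trm_val (gw_tree undefined) e s = trm_val (gw_tree undefined) e t"
    have "sat (gw_tree \<omega>) e (Eq s t) = b" for \<omega>
      using tr[of \<omega> e s undefined] tr[of \<omega> e t undefined] by (simp add: b_def)
    then show ?case by (simp del: sat.simps)
  next
    case (Parent s t)
    let ?a = "trm_val (gw_tree undefined) e s" and ?b = "trm_val (gw_tree undefined) e t"
    have "sat (gw_tree \<omega>) e (Parent s t) \<longleftrightarrow> (\<exists>i. ?a = ?b @ [i]) \<and> ?a \<in> gw_verts \<omega>" for \<omega>
      using tr[of \<omega> e s undefined] tr[of \<omega> e t undefined]
      by (simp del: trm_val.simps, simp add: gw_tree_def) (auto simp: gw_verts_snoc_iff)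
    then show ?case using gw_verts_measurable by simp
  next
    case (Exists x \<phi>)
    have "sat (gw_tree \<omega>) e (Exists x \<phi>) \<longleftrightarrow>
        (\<exists>v. v \<in> gw_verts \<omega> \<and> sat (gw_tree \<omega>) (e(x := v)) \<phi>)" for \<omega>
      by (auto simp: gw_tree_def)
    then show ?case
      using Exists.IH gw_verts_measurable[where c = c] by (simp del: sat.simps)
  next
    case (Forall x \<phi>)
    have "sat (gw_tree \<omega>) e (Forall x \<phi>) \<longleftrightarrow>
        (\<forall>v. v \<in> gw_verts \<omega> \<longrightarrow> sat (gw_tree \<omega>) (e(x := v)) \<phi>)" for \<omega>
      by (auto simp: gw_tree_def)
    then show ?case
      using Forall.IH gw_verts_measurable[where c = c] by (simp del: sat.simps)
  }
qed auto

lemma gw_class_event_measurable: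
  assumes "j \<in> Sig k"
  shows "{\<omega> \<in> space (GW c). EV k (gw_tree \<omega>) = j} \<in> sets (GW c)"
proof -
  obtain S :: ctree where S: "rooted_tree S" "j = EV k S"
    using assms by (auto simp: Sig_def EV_def quotient_def)
  have troot: "troot (gw_tree \<omega>) = []" for \<omega>
    by (simp add: gw_tree_def)
  have "EV k (gw_tree \<omega>) = j \<longleftrightarrow>
      (\<forall>\<phi>. sentence \<phi> \<and> qdepth \<phi> \<le> k \<longrightarrow> sat (gw_tree \<omega>) (\<lambda>_. []) \<phi> = models S \<phi>)" for \<omega>
    using EV_eq_iff[OF rooted_tree_gw_tree S(1)] S(2) troot
    by (simp add: equiv_upto_def models_def[of "gw_tree \<omega>"])
  moreover have "Measurable.pred (GW c)
      (\<lambda>\<omega>. sentence \<phi> \<and> qdepth \<phi> \<le> k \<longrightarrow> sat (gw_tree \<omega>) (\<lambda>_. []) \<phi> = models S \<phi>)" for \<phi>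
    using sat_gw_tree_measurable[where c = c]
    by (cases "sentence \<phi> \<and> qdepth \<phi> \<le> k"; cases "models S \<phi>") simp_all
  then have "Measurable.pred (GW c)
      (\<lambda>\<omega>. \<forall>\<phi>. sentence \<phi> \<and> qdepth \<phi> \<le> k \<longrightarrow> sat (gw_tree \<omega>) (\<lambda>_. []) \<phi> = models S \<phi>)"
    by (rule pred_intros_countable(1))
  ultimately show ?thesis by (simp only: pred_def)
qed

end

theory Submission
  imports Defs
begin

text \<open>
  Duplicator wins the \<open>k\<close>-move game on two trees with equal child tallies: she answers a move below
  a fresh rootchild by a fresh rootchild of the same class, and then follows her strategy on the two
  subtrees. A fresh partner exists because fewer than \<open>k\<close> rootchildren are in use before any
  move, so counting up to \<open>k\<close> suffices. Hence \<open>\<Gamma>\<close> computes the class of a tree from the classes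
  at its rootchildren. In the Galton-Watson tree these are, independently of the Poisson number of
  rootchildren, independent copies of the class of the whole tree, which is the fixed point equation.
\<close>

section \<open>Ehrenfeucht games\<close>

text \<open>The classes are given by sentences and the gluing argument by a game, so equality of
  classes must be turned into a strategy and back. The hard direction rests on Hintikka's
  observation: in this finite language an \<open>n\<close>-move position has only finitely many
  types, each written as one formula of depth at most \<open>n\<close>, so the existence of a
  partner of the same type is a single existential statement. The same finite list bounds the number
  of classes, which makes the sums over label vectors finite. On the probabilistic side, the root
  count decides which branches belong to the tree, and this seems to tie the branches to it. The
  obstacle disappears because every word carries an offspring number, whether or not it is a vertex:
  branch \<open>i\<close> is read off from the words beginning with \<open>i\<close>, for every
  \<open>i\<close>, and these blocks of coordinates are disjoint from each other and from the root
  word.\<close>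

definition partial_iso :: "'a rtree \<Rightarrow> 'b rtree \<Rightarrow> ('a \<times> 'b) set \<Rightarrow> bool" where
  "partial_iso T T' P \<longleftrightarrow> (troot T, troot T') \<in> P \<and>
     (\<forall>(a, b) \<in> P. \<forall>(c, d) \<in> P.
        (a = c \<longleftrightarrow> b = d) \<and> ((a, c) \<in> par T \<longleftrightarrow> (b, d) \<in> par T'))"

text \<open>A position is a set of pairs, since neither the order nor the repetition of moves
  matters. Requiring a partial isomorphism at every stage lets a position be weakened to fewer moves
  without assuming that there are vertices to play.\<close>

primrec back_forth :: "nat \<Rightarrow> 'a rtree \<Rightarrow> 'b rtree \<Rightarrow> ('a \<times> 'b) set \<Rightarrow> bool" where
  "back_forth 0 T T' P \<longleftrightarrow> partial_iso T T' P"
| "back_forth (Suc n) T T' P \<longleftrightarrow> partial_iso T T' P \<and>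
     (\<forall>v \<in> verts T. \<exists>v' \<in> verts T'. back_forth n T T' (insert (v, v') P)) \<and>
     (\<forall>v' \<in> verts T'. \<exists>v \<in> verts T. back_forth n T T' (insert (v, v') P))"

lemma back_forth_partial_iso: "back_forth n T T' P \<Longrightarrow> partial_iso T T' P"
  by (cases n) auto

lemma back_forth_Suc: "back_forth (Suc n) T T' P \<Longrightarrow> back_forth n T T' P"
proof (induction n arbitrary: P)
  case (Suc n)
  have "partial_iso T T' P" using Suc.prems by (rule back_forth_partial_iso)
  moreover have "\<exists>v'\<in>verts T'. back_forth n T T' (insert (v, v') P)" if "v \<in> verts T" for v
    using Suc.prems Suc.IH that by (meson back_forth.simps(2))
  moreover have "\<exists>v\<in>verts T. back_forth n T T' (insert (v, v') P)" if "v' \<in> verts T'" for v'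
    using Suc.prems Suc.IH that by (meson back_forth.simps(2))
  ultimately show ?case by simp
qed simp

lemma back_forth_antimono: "m \<le> n \<Longrightarrow> back_forth n T T' P \<Longrightarrow> back_forth m T T' P"
  by (induction n rule: dec_induct) (use back_forth_Suc in blast)+

lemma partial_iso_converse: "partial_iso T' T (P\<inverse>) \<longleftrightarrow> partial_iso T T' P"
proof -
  have "(\<forall>(b, a)\<in>P\<inverse>. \<forall>(d, c)\<in>P\<inverse>. Q a b c d) \<longleftrightarrow> (\<forall>(a, b)\<in>P. \<forall>(c, d)\<in>P. Q a b c d)" for Q
    by blast
  from this[of "\<lambda>a b c d. (b = d \<longleftrightarrow> a = c) \<and> ((b, d) \<in> par T' \<longleftrightarrow> (a, c) \<in> par T)"]
  show ?thesis unfolding partial_iso_def by (simp add: eq_commute)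
qed

text \<open>Symmetry of the game: the composed strategy then has to be described only for moves of
  Spoiler in the first tree.\<close>

lemma back_forth_converse: "back_forth n T' T (P\<inverse>) \<longleftrightarrow> back_forth n T T' P"
proof (induction n arbitrary: P)
  case (Suc n)
  have "insert (b, a) (P\<inverse>) = (insert (a, b) P)\<inverse>" for a b by auto
  then show ?case by (auto simp: partial_iso_converse Suc.IH)
qed (simp add: partial_iso_converse)

text \<open>\<open>P\<close> may hold more pairs than the free variables reach: rebinding a variable
  drops its old value from the assignment, but the old pair stays in the position.\<close>

lemma back_forth_sat:
  assumes "back_forth n T T' P" "qdepth \<phi> \<le> n" "\<forall>x\<in>free_vars \<phi>. (e x, e' x) \<in> P"
  shows "sat T e \<phi> \<longleftrightarrow> sat T' e' \<phi>"
  using assms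
proof (induction \<phi> arbitrary: n P e e')
  have tv: "(trm_val T e t, trm_val T' e' t) \<in> P"
    if "partial_iso T T' P" "\<forall>x\<in>trm_vars t. (e x, e' x) \<in> P" for P e e' t
    using that by (cases t) (auto simp: partial_iso_def)
  {
    case (Eq s t)
    then have p: "partial_iso T T' P" by (blast dest: back_forth_partial_iso)
    then show ?case
      using tv[OF p, of s e e'] tv[OF p, of t e e'] Eq(3) by (fastforce simp: partial_iso_def)
  next
    case (Parent s t)
    then have p: "partial_iso T T' P" by (blast dest: back_forth_partial_iso)
    then show ?case
      using tv[OF p, of s e e'] tv[OF p, of t e e'] Parent(3) by (fastforce simp: partial_iso_def)
  next
    case (Neg \<phi>)
    then show ?case by simp
  next
    case (Conj \<phi> \<psi>)
    have "sat T e \<phi> \<longleftrightarrow> sat T' e' \<phi>" "sat T e \<psi> \<longleftrightarrow> sat T' e' \<psi>"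
      using Conj.prems by (intro Conj.IH[of n P]; simp)+
    then show ?case by simp
  next
    case (Disj \<phi> \<psi>)
    have "sat T e \<phi> \<longleftrightarrow> sat T' e' \<phi>" "sat T e \<psi> \<longleftrightarrow> sat T' e' \<psi>"
      using Disj.prems by (intro Disj.IH[of n P]; simp)+
    then show ?case by simp
  next
    case (Exists x \<phi>)
    then obtain m where n: "n = Suc m" by (cases n) auto
    have "sat T (e(x := v)) \<phi> \<longleftrightarrow> sat T' (e'(x := v')) \<phi>"
      if "back_forth m T T' (insert (v, v') P)" for v v'
      using Exists.prems n by (intro Exists.IH[OF that]) auto
    then show ?case using Exists.prems(1) n by simp metis
  next
    case (Forall x \<phi>)
    then obtain m where n: "n = Suc m" by (cases n) auto
    have "sat T (e(x := v)) \<phi> \<longleftrightarrow> sat T' (e'(x := v')) \<phi>"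
      if "back_forth m T T' (insert (v, v') P)" for v v'
      using Forall.prems n by (intro Forall.IH[OF that]) auto
    then show ?case using Forall.prems(1) n by simp metis
  }
qed

section \<open>Finitely many formulas that decide the game\<close>

text \<open>Complete types over a list of formulas: every assignment satisfies a member, and two
  assignments satisfying the same member agree on the whole list. \<open>Eq Root Root\<close> stands
  for truth.\<close>

fun sign_conjs :: "form list \<Rightarrow> form list" where
  "sign_conjs [] = [Eq Root Root]"
| "sign_conjs (\<phi> # \<phi>s) =
     map (Conj \<phi>) (sign_conjs \<phi>s) @ map (Conj (Neg \<phi>)) (sign_conjs \<phi>s)"

lemma sat_sign_conjs_ex: "\<exists>\<psi>\<in>set (sign_conjs \<phi>s). sat T e \<psi>"
proof (induction \<phi>s)
  case (Cons \<phi> \<phi>s)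
  then obtain \<psi> where "\<psi> \<in> set (sign_conjs \<phi>s)" "sat T e \<psi>" by blast
  then show ?case
    by (intro bexI[of _ "Conj (if sat T e \<phi> then \<phi> else Neg \<phi>) \<psi>"]) auto
qed simp

lemma sat_sign_conjs_agree:
  assumes "\<psi> \<in> set (sign_conjs \<phi>s)" "sat T e \<psi>" "sat T' e' \<psi>" "\<phi> \<in> set \<phi>s"
  shows "sat T e \<phi> \<longleftrightarrow> sat T' e' \<phi>"
  using assms by (induction \<phi>s arbitrary: \<psi>) auto

lemma qdepth_sign_conjs:
  "\<psi> \<in> set (sign_conjs \<phi>s) \<Longrightarrow> (\<And>\<phi>. \<phi> \<in> set \<phi>s \<Longrightarrow> qdepth \<phi> \<le> n) \<Longrightarrow> qdepth \<psi> \<le> n"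
  by (induction \<phi>s arbitrary: \<psi>) auto

lemma free_vars_sign_conjs:
  "\<psi> \<in> set (sign_conjs \<phi>s) \<Longrightarrow> (\<And>\<phi>. \<phi> \<in> set \<phi>s \<Longrightarrow> free_vars \<phi> \<subseteq> X) \<Longrightarrow> free_vars \<psi> \<subseteq> X"
proof (induction \<phi>s arbitrary: \<psi>)
  case (Cons \<phi> \<phi>s)
  then obtain \<psi>' where "\<psi>' \<in> set (sign_conjs \<phi>s)" "free_vars \<psi> = free_vars \<phi> \<union> free_vars \<psi>'"
    by auto
  then show ?case using Cons.IH[of \<psi>'] Cons.prems(2) by auto
qed simp

definition atoms :: "nat \<Rightarrow> form list" where
  "atoms m = (let ts = Root # map Var [0..<m] in
     map (case_prod Eq) (List.product ts ts) @ map (case_prod Parent) (List.product ts ts))"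

text \<open>
  Finitely many formulas in the variables \<open>0, \<dots>, m - 1\<close> whose truth values determine the
  \<open>n\<close>-move game.
\<close>

primrec game_forms :: "nat \<Rightarrow> nat \<Rightarrow> form list" where
  "game_forms 0 m = atoms m"
| "game_forms (Suc n) m = atoms m @ map (Exists m) (sign_conjs (game_forms n (Suc m)))"

lemma set_atoms:
  "set (atoms m) = (\<Union>s \<in> insert Root (Var ` {..<m}). \<Union>t \<in> insert Root (Var ` {..<m}).
     {Eq s t, Parent s t})"
  by (auto simp: atoms_def Let_def)

lemma qdepth_game_forms: "\<phi> \<in> set (game_forms n m) \<Longrightarrow> qdepth \<phi> \<le> n"
proof (induction n arbitrary: m \<phi>)
  case (Suc n)
  then show ?case
    using qdepth_sign_conjs[of _ "game_forms n (Suc m)" n] by (auto simp: set_atoms)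
qed (auto simp: set_atoms)

lemma free_vars_game_forms: "\<phi> \<in> set (game_forms n m) \<Longrightarrow> free_vars \<phi> \<subseteq> {..<m}"
proof (induction n arbitrary: m \<phi>)
  case (Suc n)
  have "free_vars \<psi> \<subseteq> {..<Suc m}" if "\<psi> \<in> set (sign_conjs (game_forms n (Suc m)))" for \<psi>
    using free_vars_sign_conjs[OF that] Suc.IH by blast
  then show ?case using Suc.prems by (fastforce simp: set_atoms)
qed (auto simp: set_atoms)

lemma atoms_partial_iso:
  assumes "\<forall>\<phi>\<in>set (atoms m). sat T e \<phi> \<longleftrightarrow> sat T' e' \<phi>"
  shows "partial_iso T T' (insert (troot T, troot T') ((\<lambda>i. (e i, e' i)) ` {..<m}))"
proof -
  define ts where "ts = insert Root (Var ` {..<m})"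
  have P: "insert (troot T, troot T') ((\<lambda>i. (e i, e' i)) ` {..<m})
      = (\<lambda>t. (trm_val T e t, trm_val T' e' t)) ` ts"
    by (simp add: ts_def image_image)
  have "sat T e (Eq s t) \<longleftrightarrow> sat T' e' (Eq s t)"
    "sat T e (Parent s t) \<longleftrightarrow> sat T' e' (Parent s t)" if "s \<in> ts" "t \<in> ts" for s t
    using assms that unfolding set_atoms ts_def by blast+
  moreover have "(troot T, troot T') \<in> (\<lambda>t. (trm_val T e t, trm_val T' e' t)) ` ts"
    by (rule image_eqI[of _ _ Root]) (auto simp: ts_def)
  ultimately show ?thesis
    unfolding partial_iso_def P by simp
qed

text \<open>Spoiler's vertex \<open>v\<close>, stored in the next variable \<open>m\<close>,
  satisfies some complete type \<open>\<psi>\<close> over the formulas for the remaining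
  \<open>n\<close> moves. As \<open>Exists m \<psi>\<close> is on the list, the other tree has a
  vertex of the same type, and the induction hypothesis applies to the two enlarged
  assignments.\<close>

lemma game_forms_back_forth:
  assumes "\<forall>\<phi>\<in>set (game_forms n m). sat T e \<phi> \<longleftrightarrow> sat T' e' \<phi>"
  shows "back_forth n T T' (insert (troot T, troot T') ((\<lambda>i. (e i, e' i)) ` {..<m}))"
  using assms
proof (induction n arbitrary: m e e')
  case 0
  then show ?case by (simp add: atoms_partial_iso)
next
  case (Suc n)
  let ?P = "\<lambda>e e' m. insert (troot T, troot T') ((\<lambda>i. (e i, e' i)) ` {..<m})"
  have P: "?P (e(m := v)) (e'(m := v')) (Suc m) = insert (v, v') (?P e e' m)" for v v'
    by (auto simp: lessThan_Suc)
  have match: "back_forth n T T' (insert (v, v') (?P e e' m))"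
    if "\<psi> \<in> set (sign_conjs (game_forms n (Suc m)))"
      "sat T (e(m := v)) \<psi>" "sat T' (e'(m := v')) \<psi>" for v v' \<psi>
    using Suc.IH[of "Suc m" "e(m := v)" "e'(m := v')"] sat_sign_conjs_agree[OF that]
    unfolding P by blast
  have ex: "(\<exists>v\<in>verts T. sat T (e(m := v)) \<psi>) \<longleftrightarrow> (\<exists>v'\<in>verts T'. sat T' (e'(m := v')) \<psi>)"
    if "\<psi> \<in> set (sign_conjs (game_forms n (Suc m)))" for \<psi>
  proof -
    have "Exists m \<psi> \<in> set (game_forms (Suc n) m)" using that by simp
    then have "sat T e (Exists m \<psi>) \<longleftrightarrow> sat T' e' (Exists m \<psi>)" using Suc.prems by blast
    then show ?thesis by simp
  qed
  have "\<exists>v'\<in>verts T'. back_forth n T T' (insert (v, v') (?P e e' m))" if "v \<in> verts T" for v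
    using sat_sign_conjs_ex[of "game_forms n (Suc m)" T "e(m := v)"] ex match that by meson
  moreover have "\<exists>v\<in>verts T. back_forth n T T' (insert (v, v') (?P e e' m))"
    if "v' \<in> verts T'" for v'
    using sat_sign_conjs_ex[of "game_forms n (Suc m)" T' "e'(m := v')"] ex match that by meson
  ultimately show ?case
    using atoms_partial_iso[of m T e T' e'] Suc.prems by simp
qed

lemma models_game_forms_back_forth:
  assumes "\<forall>\<phi>\<in>set (game_forms k 0). models T \<phi> \<longleftrightarrow> models T' \<phi>"
  shows "back_forth k T T' {(troot T, troot T')}"
  using game_forms_back_forth[of k 0 T _ T'] assms unfolding models_def by auto

lemma equiv_upto_iff_back_forth:
  "equiv_upto k T T' \<longleftrightarrow> back_forth k T T' {(troot T, troot T')}"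
proof
  assume "equiv_upto k T T'"
  then show "back_forth k T T' {(troot T, troot T')}"
    using qdepth_game_forms[of _ k 0] free_vars_game_forms[of _ k 0]
    by (intro models_game_forms_back_forth) (auto simp: equiv_upto_def sentence_def)
next
  assume "back_forth k T T' {(troot T, troot T')}"
  then show "equiv_upto k T T'"
    using back_forth_sat by (fastforce simp: equiv_upto_def sentence_def models_def)
qed

text \<open>The sentences of \<open>game_forms k 0\<close> that hold in a tree determine its class.
  Choosing one tree for each realised subset by \<open>inv_into\<close> covers \<open>Sig k\<close>
  by an image of a finite power set.\<close>

lemma finite_Sig: "finite (Sig k)"
proof -
  let ?f = "\<lambda>T :: ctree. {\<phi> \<in> set (game_forms k 0). models T \<phi>}"
  have EV: "EV k T = EV k T'" if "rooted_tree T" "rooted_tree T'" "?f T = ?f T'" for T T' :: ctree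
  proof -
    have "back_forth k T T' {(troot T, troot T')}"
      using that(3) by (intro models_game_forms_back_forth) blast
    then show ?thesis using that by (simp add: EV_eq_iff equiv_upto_iff_back_forth)
  qed
  have "Sig k \<subseteq> EV k ` {T :: ctree. rooted_tree T}"
    by (auto simp: Sig_def EV_def quotient_def)
  moreover have "EV k T = EV k (inv_into {T. rooted_tree T} ?f (?f T))" if "rooted_tree T" for T :: ctree
    using that f_inv_into_f[of "?f T" ?f "{T. rooted_tree T}"]
      inv_into_into[of "?f T" ?f "{T. rooted_tree T}"] by (intro EV) auto
  ultimately have "Sig k \<subseteq> (\<lambda>A. EV k (inv_into {T. rooted_tree T} ?f A)) ` Pow (set (game_forms k 0))"
    by blast
  then show ?thesis by (rule finite_subset) simp
qed

section \<open>Gluing games along the rootchildren\<close>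

lemma rooted_tree_single_valued: "rooted_tree T \<Longrightarrow> single_valued (par T)"
  unfolding rooted_tree_def single_valued_def by blast

lemma root_rtrancl_iff: "rooted_tree T \<Longrightarrow> (troot T, w) \<in> (par T)\<^sup>* \<longleftrightarrow> w = troot T"
  unfolding rooted_tree_def by (metis converse_rtranclE rtrancl.rtrancl_refl)

lemma rooted_tree_subtree:
  assumes T: "rooted_tree T" and c: "c \<in> verts T"
  shows "rooted_tree (subtree T c)"
proof -
  have p: "par T \<subseteq> verts T \<times> verts T"
    and un: "\<And>v. v \<in> verts T - {troot T} \<Longrightarrow> \<exists>!w. (v, w) \<in> par T"
    using T by (auto simp: rooted_tree_def)
  have sv: "single_valued (par T)" by (rule rooted_tree_single_valued[OF T])
  let ?D = "descendants T c" let ?p = "par T \<inter> ?D \<times> ?D"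
  \<comment> \<open>A parent of \<open>c\<close> among its own descendants would close a cycle.
    Parents are unique, so everything on the upward path from \<open>c\<close> leads back to
    \<open>c\<close>. That path reaches the root, so the root would have \<open>c\<close> as an
    ancestor, which forces \<open>c\<close> to be the root; but the root has no parent.\<close>
  have acyc: "(c, w) \<notin> par T" if "w \<in> ?D" for w
  proof
    assume cw: "(c, w) \<in> par T"
    have "(c, troot T) \<in> (par T)\<^sup>*" using T c by (simp add: rooted_tree_def)
    have "(w, c) \<in> (par T)\<^sup>*" using that by (simp add: descendants_def)
    have "(x, c) \<in> (par T)\<^sup>*" if "(c, x) \<in> (par T)\<^sup>*" for x
      using that
    proof induction
      case (step y z)
      from step.IH show ?case
      proof (cases rule: converse_rtranclE)
        case base
        then have "z = w" using step.hyps cw sv by (auto dest: single_valuedD)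
        then show ?thesis using \<open>(w, c) \<in> (par T)\<^sup>*\<close> by simp
      next
        case (step z')
        then have "z = z'" using \<open>(y, z) \<in> par T\<close> sv by (auto dest: single_valuedD)
        then show ?thesis using step by simp
      qed
    qed simp
    then have "(troot T, c) \<in> (par T)\<^sup>*" using \<open>(c, troot T) \<in> (par T)\<^sup>*\<close> by blast
    then show False using cw T by (simp add: root_rtrancl_iff) (simp add: rooted_tree_def)
  qed
  have up: "w \<in> ?D" if "v \<in> ?D" "v \<noteq> c" "(v, w) \<in> par T" for v w
  proof -
    have "(v, c) \<in> (par T)\<^sup>+" using that by (auto simp: descendants_def rtrancl_eq_or_trancl)
    then obtain w' where "(v, w') \<in> par T" "(w', c) \<in> (par T)\<^sup>*" by (auto dest: tranclD)
    moreover have "w' = w" using calculation that sv by (auto dest: single_valuedD)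
    ultimately show ?thesis using p by (auto simp: descendants_def)
  qed
  have "\<exists>!w. (v, w) \<in> ?p" if v: "v \<in> ?D" "v \<noteq> c" for v
  proof -
    have "v \<noteq> troot T" using v T by (auto simp: descendants_def root_rtrancl_iff)
    then have "\<exists>!w. (v, w) \<in> par T" using un v by (auto simp: descendants_def)
    then show ?thesis using up[OF v] v by blast
  qed
  moreover have "(v, c) \<in> ?p\<^sup>*" if "v \<in> ?D" for v
  proof -
    have "(v, c) \<in> (par T)\<^sup>*" using that by (simp add: descendants_def)
    then show ?thesis using that
    proof (induction rule: converse_rtrancl_induct)
      case (step y z)
      then have "z \<in> ?D" using p by (auto simp: descendants_def)
      then show ?case using step by (auto intro: converse_rtrancl_into_rtrancl)
    qed simp
  qed
  ultimately show ?thesis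
    using c acyc unfolding rooted_tree_def subtree_def by (auto simp: descendants_def)
qed

lemma rootchild_in_verts: "rooted_tree T \<Longrightarrow> c \<in> rootchildren T \<Longrightarrow> c \<in> verts T"
  by (auto simp: rooted_tree_def rootchildren_def)

lemma rootchild_in_descendants: "rooted_tree T \<Longrightarrow> c \<in> rootchildren T \<Longrightarrow> c \<in> descendants T c"
  by (auto simp: descendants_def rootchild_in_verts)

lemma root_notin_descendants:
  "rooted_tree T \<Longrightarrow> c \<in> rootchildren T \<Longrightarrow> troot T \<notin> descendants T c"
  by (auto simp: descendants_def root_rtrancl_iff) (auto simp: rootchildren_def rooted_tree_def)

lemma vertex_cases:
  assumes "rooted_tree T" "v \<in> verts T"
  obtains "v = troot T" | c where "c \<in> rootchildren T" "v \<in> descendants T c"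
proof -
  have "(v, troot T) \<in> (par T)\<^sup>*" using assms by (simp add: rooted_tree_def)
  then show thesis
    by (cases rule: rtranclE) (use assms that in \<open>auto simp: rootchildren_def descendants_def\<close>)
qed

text \<open>Parents are unique, so two ancestors of \<open>v\<close> lie on one upward path; and the
  only proper ancestor of a rootchild is the root.\<close>

lemma descendants_disjoint:
  assumes T: "rooted_tree T" and "c \<in> rootchildren T" "d \<in> rootchildren T"
    and v: "v \<in> descendants T c" "v \<in> descendants T d"
  shows "c = d"
proof -
  have sv: "single_valued (par T)" by (rule rooted_tree_single_valued[OF T])
  have *: "x = y" if x: "x \<in> rootchildren T" and y: "y \<in> rootchildren T"
    and xy: "(x, y) \<in> (par T)\<^sup>*" for x y
    using xy
  proof (cases rule: converse_rtranclE)
    case (step z)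
    then have "z = troot T" using x sv by (auto simp: rootchildren_def dest: single_valuedD)
    then have "y = troot T" using step T by (simp add: root_rtrancl_iff)
    then show ?thesis using y T by (auto simp: rootchildren_def rooted_tree_def)
  qed
  have "(c, d) \<in> (par T)\<^sup>* \<or> (d, c) \<in> (par T)\<^sup>*"
    using single_valued_confluent[OF sv] v by (auto simp: descendants_def)
  then show ?thesis using * assms by metis
qed

lemma descendants_child:
  "rooted_tree T \<Longrightarrow> b \<in> descendants T c \<Longrightarrow> (a, b) \<in> par T \<Longrightarrow> a \<in> descendants T c"
  by (auto simp: descendants_def rooted_tree_def intro: converse_rtrancl_into_rtrancl)

lemma troot_subtree [simp]: "troot (subtree T c) = c"
  and verts_subtree [simp]: "verts (subtree T c) = descendants T c"
  and par_subtree [simp]: "par (subtree T c) = par T \<inter> (descendants T c \<times> descendants T c)"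
  by (auto simp: subtree_def)

text \<open>
  The composed strategy on \<open>T\<close> and \<open>T'\<close>: the rootchildren below which a move has been made are
  matched by \<open>M\<close>, and below each matched pair Duplicator is winning the game on the two subtrees.
\<close>

definition glued :: "nat \<Rightarrow> 'a rtree \<Rightarrow> 'b rtree \<Rightarrow> nat \<Rightarrow> ('a \<times> 'b) set \<Rightarrow> ('a \<times> 'b) set \<Rightarrow> bool"
  where
  "glued k T T' n P M \<longleftrightarrow>
     (troot T, troot T') \<in> P \<and> finite M \<and> M \<subseteq> rootchildren T \<times> rootchildren T' \<and>
     (\<forall>c c' d d'. (c, c') \<in> M \<and> (d, d') \<in> M \<longrightarrow> (c = d \<longleftrightarrow> c' = d')) \<and>
     (\<forall>c c'. (c, c') \<in> M \<longrightarrow> EV k (subtree T c) = EV k (subtree T' c') \<and>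
        back_forth n (subtree T c) (subtree T' c')
          (insert (c, c') (P \<inter> (descendants T c \<times> descendants T' c')))) \<and>
     (\<forall>a b. (a, b) \<in> P \<longrightarrow> a = troot T \<and> b = troot T' \<or>
        (\<exists>c c'. (c, c') \<in> M \<and> a \<in> descendants T c \<and> b \<in> descendants T' c'))"

lemma glued_converse:
  assumes "glued k T T' n P M"
  shows "glued k T' T n (P\<inverse>) (M\<inverse>)"
proof -
  have eq: "insert (c', c) (P\<inverse> \<inter> (descendants T' c' \<times> descendants T c)) =
    (insert (c, c') (P \<inter> (descendants T c \<times> descendants T' c')))\<inverse>" for c c'
    by auto
  show ?thesis
    using assms unfolding glued_def eq converse_iff back_forth_converse finite_converse
    by (intro conjI) (blast | metis)+
qed

lemma glued_Suc: "glued k T T' (Suc n) P M \<Longrightarrow> glued k T T' n P M"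
  unfolding glued_def using back_forth_Suc by fast

lemma partial_isoD:
  assumes "partial_iso T T' P" "(a, b) \<in> P" "(c, d) \<in> P"
  shows "a = c \<longleftrightarrow> b = d" "(a, c) \<in> par T \<longleftrightarrow> (b, d) \<in> par T'"
proof -
  note * = bspec[OF conjunct2[OF assms(1)[unfolded partial_iso_def]] assms(2), unfolded prod.case]
  show "a = c \<longleftrightarrow> b = d" "(a, c) \<in> par T \<longleftrightarrow> (b, d) \<in> par T'"
    using bspec[OF * assms(3)] by simp_all
qed

lemma gluedI:
  assumes "(troot T, troot T') \<in> P" "finite M" "M \<subseteq> rootchildren T \<times> rootchildren T'"
    and "\<And>p q. p \<in> M \<Longrightarrow> q \<in> M \<Longrightarrow> fst p = fst q \<longleftrightarrow> snd p = snd q"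
    and "\<And>c c'. (c, c') \<in> M \<Longrightarrow> EV k (subtree T c) = EV k (subtree T' c')"
    and "\<And>c c'. (c, c') \<in> M \<Longrightarrow> back_forth n (subtree T c) (subtree T' c')
          (insert (c, c') (P \<inter> (descendants T c \<times> descendants T' c')))"
    and "\<And>a b. (a, b) \<in> P \<Longrightarrow> a = troot T \<and> b = troot T' \<or>
        (\<exists>c c'. (c, c') \<in> M \<and> a \<in> descendants T c \<and> b \<in> descendants T' c')"
  shows "glued k T T' n P M"
  using assms unfolding glued_def by (intro conjI allI impI) (simp_all, metis fst_conv snd_conv)

lemma gluedD:
  assumes "glued k T T' n P M"
  shows "(troot T, troot T') \<in> P" "finite M" "M \<subseteq> rootchildren T \<times> rootchildren T'"
    and "(c, c') \<in> M \<Longrightarrow> (d, d') \<in> M \<Longrightarrow> c = d \<longleftrightarrow> c' = d'"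
    and "(c, c') \<in> M \<Longrightarrow> c \<in> rootchildren T"
    and "(c, c') \<in> M \<Longrightarrow> c' \<in> rootchildren T'"
    and "(c, c') \<in> M \<Longrightarrow> EV k (subtree T c) = EV k (subtree T' c')"
    and "(c, c') \<in> M \<Longrightarrow> back_forth n (subtree T c) (subtree T' c')
          (insert (c, c') (P \<inter> (descendants T c \<times> descendants T' c')))"
    and "(a, b) \<in> P \<Longrightarrow> a = troot T \<and> b = troot T' \<or>
        (\<exists>c c'. (c, c') \<in> M \<and> a \<in> descendants T c \<and> b \<in> descendants T' c')"
  using assms unfolding glued_def by (simp_all, blast+)

text \<open>Pairs below the same matched rootchildren are handled by their subgame, and no edge
  joins vertices below different rootchildren. Edges to the root start at a rootchild: this is why
  \<open>(c, c')\<close> is part of every subgame position, for it makes \<open>a = c\<close>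
  equivalent to \<open>b = c'\<close> whenever \<open>(a, b)\<close> has been played there.\<close>

lemma glued_partial_iso:
  assumes T: "rooted_tree T" "rooted_tree T'" and g: "glued k T T' n P M"
  shows "partial_iso T T' P"
proof -
  let ?Q = "\<lambda>c c'. insert (c, c') (P \<inter> (descendants T c \<times> descendants T' c'))"
  note M = gluedD(5,6)[OF g] and inj = gluedD(4)[OF g] and P = gluedD(9)[OF g]
  have Q: "(x = y \<longleftrightarrow> x' = y') \<and> ((x, y) \<in> par T \<longleftrightarrow> (x', y') \<in> par T')"
    if c: "(c, c') \<in> M" and xy: "(x, x') \<in> ?Q c c'" "(y, y') \<in> ?Q c c'" for x x' y y' c c'
  proof -
    have "(x = y \<longleftrightarrow> x' = y') \<and> ((x, y) \<in> par (subtree T c) \<longleftrightarrow> (x', y') \<in> par (subtree T' c'))"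
      using partial_isoD[OF back_forth_partial_iso[OF gluedD(8)[OF g c]] xy] by blast
    moreover have "x \<in> descendants T c" "y \<in> descendants T c"
        "x' \<in> descendants T' c'" "y' \<in> descendants T' c'"
      using xy M[OF c] rootchild_in_descendants[OF T(1)] rootchild_in_descendants[OF T(2)] by auto
    ultimately show ?thesis by simp
  qed
  have to_root: "(a, troot T) \<in> par T \<longleftrightarrow> a = c"
    if "rooted_tree T" "c \<in> rootchildren T" "a \<in> descendants T c" for a c and T :: "'c rtree"
    using that descendants_disjoint[of T a c a] rootchild_in_descendants[of T]
    by (auto simp: rootchildren_def)
  have root: "(a = troot T \<longleftrightarrow> b = troot T') \<and> ((a, troot T) \<in> par T \<longleftrightarrow> (b, troot T') \<in> par T')"
    if "(a, b) \<in> P" for a b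
    using P[OF that]
  proof
    assume "\<exists>c c'. (c, c') \<in> M \<and> a \<in> descendants T c \<and> b \<in> descendants T' c'"
    then obtain c c' where c: "(c, c') \<in> M" "a \<in> descendants T c" "b \<in> descendants T' c'" by blast
    have "a = c \<longleftrightarrow> b = c'" using Q[OF c(1), of a b c c'] c that by simp
    then show ?thesis
      using c M(1,2)[OF c(1)] T to_root[of T c a] to_root[of T' c' b]
        root_notin_descendants[of T c] root_notin_descendants[of T' c'] by auto
  qed (use T in \<open>auto simp: rooted_tree_def\<close>)
  have no_root: "(troot T, a) \<notin> par T" if "rooted_tree T" for a and T :: "'c rtree"
    using that by (simp add: rooted_tree_def)
  have "(a = d \<longleftrightarrow> b = e) \<and> ((a, d) \<in> par T \<longleftrightarrow> (b, e) \<in> par T')"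
    if ab: "(a, b) \<in> P" and de: "(d, e) \<in> P" for a b d e
  proof (cases "a = troot T \<or> d = troot T")
    case True
    then show ?thesis using root[OF ab] root[OF de] no_root[OF T(1)] no_root[OF T(2)] by metis
  next
    case False
    then obtain c c' where c: "(c, c') \<in> M" "a \<in> descendants T c" "b \<in> descendants T' c'"
      using P[OF ab] by blast
    obtain f f' where f: "(f, f') \<in> M" "d \<in> descendants T f" "e \<in> descendants T' f'"
      using P[OF de] False by blast
    show ?thesis
    proof (cases "c = f")
      case True
      then have "c' = f'" using inj[OF c(1) f(1)] by simp
      then show ?thesis using Q[OF c(1), of a b d e] c f ab de True by simp
    next
      case False
      then have ne: "c' \<noteq> f'" using inj[OF c(1) f(1)] by simp
      have "a \<notin> descendants T f"
        using False c(2) descendants_disjoint[OF T(1) M(1)[OF c(1)] M(1)[OF f(1)]] by blast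
      moreover have "b \<notin> descendants T' f'"
        using ne c(3) descendants_disjoint[OF T(2) M(2)[OF c(1)] M(2)[OF f(1)]] by blast
      ultimately show ?thesis
        using f descendants_child[OF T(1) f(2), of a] descendants_child[OF T(2) f(3), of b] by blast
    qed
  qed
  then show ?thesis using gluedD(1)[OF g] by (simp add: partial_iso_def split_beta)
qed

section \<open>Answering a move in the composed game\<close>

text \<open>Matched rootchildren keep the same class for \<open>k\<close> even when only
  \<open>n\<close> moves are left, because the tallies count classes for \<open>k\<close>: thus
  equally many children of each class are in use on both sides.\<close>

lemma glued_extend_match:
  assumes T: "rooted_tree T" "rooted_tree T'" and tal: "child_tallies k T = child_tallies k T'"
    and g: "glued k T T' n P M" and n: "n \<le> k" "card M < k" and c: "c \<in> rootchildren T"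
  shows "\<exists>M' c'. glued k T T' n P M' \<and> (c, c') \<in> M' \<and> card M' \<le> Suc (card M)"
proof (cases "c \<in> Domain M")
  case True
  then show ?thesis using g by (metis Domain.cases le_SucI order_refl)
next
  case False
  define j where "j = EV k (subtree T c)"
  let ?A = "{v \<in> rootchildren T. EV k (subtree T v) = j}"
  let ?B = "{v \<in> rootchildren T'. EV k (subtree T' v) = j}"
  let ?N = "{p \<in> M. EV k (subtree T (fst p)) = j}"
  note M = gluedD(2,3)[OF g] and inj = gluedD(4)[OF g] and EVM = gluedD(7)[OF g]
    and P = gluedD(9)[OF g]
  have "j \<in> Sig k"
    unfolding j_def using T(1) c by (intro EV_in_Sig rooted_tree_subtree rootchild_in_verts)
  then have eq: "tally_of k ?A = tally_of k ?B"
    using fun_cong[OF tal, of j] by (simp add: child_tallies_def)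
  have N: "finite ?N" "card ?N < k"
    using M(1) n(2) card_mono[of M ?N] by auto
  have cardN: "card (fst ` ?N) = card ?N" "card (snd ` ?N) = card ?N"
  proof -
    have "p = q \<longleftrightarrow> fst p = fst q" "p = q \<longleftrightarrow> snd p = snd q" if "p \<in> M" "q \<in> M" for p q
      using inj[of "fst p" "snd p" "fst q" "snd q"] that by (auto simp: prod_eq_iff)
    then have "inj_on fst ?N" "inj_on snd ?N" by (simp_all add: inj_on_def)
    then show "card (fst ` ?N) = card ?N" "card (snd ` ?N) = card ?N"
      by (simp_all only: card_image)
  qed
  \<comment> \<open>If all rootchildren of \<open>T'\<close> of class \<open>j\<close> were in use,
    there would be fewer than \<open>k\<close> of them, so the equal tallies would be exact counts.
    But \<open>T\<close> has at least one more: those in use and the new child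
    \<open>c\<close>.\<close>
  have "\<not> ?B \<subseteq> snd ` ?N"
  proof
    assume sub: "?B \<subseteq> snd ` ?N"
    have "finite (snd ` ?N)" using N(1) by (rule finite_imageI)
    then have B: "finite ?B" "card ?B \<le> card ?N"
      using finite_subset[OF sub] card_mono[OF _ sub] cardN(2) by simp_all
    then have A: "finite ?A" "card ?A = card ?B"
      using eq N(2) unfolding tally_of_def by (simp_all split: if_splits)
    have "fst ` ?N \<subseteq> ?A" using M(2) by auto
    moreover have "c \<in> ?A - fst ` ?N" using c False by (force simp: j_def)
    ultimately have "card (fst ` ?N) < card ?A"
      using A(1) by (intro psubset_card_mono) auto
    then show False using A(2) B(2) cardN(1) by simp
  qed
  then obtain c' where c': "c' \<in> rootchildren T'" "EV k (subtree T' c') = j" "c' \<notin> snd ` ?N"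
    by blast
  \<comment> \<open>So far \<open>c'\<close> only avoids partners of children of class
    \<open>j\<close>; since matches preserve the class, no other match can involve it.\<close>
  have c'M: "c' \<notin> Range M"
  proof
    assume "c' \<in> Range M"
    then obtain d where "(d, c') \<in> M" by blast
    then have "(d, c') \<in> ?N" using EVM c'(2) by simp
    then show False using c'(3) by force
  qed
  have sub: "rooted_tree (subtree T c)" "rooted_tree (subtree T' c')"
    using T c c'(1) by (auto intro!: rooted_tree_subtree rootchild_in_verts)
  have "equiv_upto k (subtree T c) (subtree T' c')"
    using c'(2) by (simp add: j_def EV_eq_iff[OF sub, symmetric])
  then have bf: "back_forth n (subtree T c) (subtree T' c') {(c, c')}"
    using back_forth_antimono[OF n(1)] by (simp add: equiv_upto_iff_back_forth)
  \<comment> \<open>Nothing has been played below the unmatched child \<open>c\<close>, so the new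
    subgame starts from its pair of roots alone.\<close>
  have "a \<notin> descendants T c" if "(a, b) \<in> P" for a b
    using P[OF that] root_notin_descendants[OF T(1) c] descendants_disjoint[OF T(1) c, of _ a]
      False M(2) by blast
  then have "P \<inter> (descendants T c \<times> descendants T' c') = {}" by blast
  moreover have "a \<in> insert (c, c') M \<Longrightarrow> b \<in> insert (c, c') M \<Longrightarrow> fst a = fst b \<longleftrightarrow> snd a = snd b"
    for a b
    using inj[of "fst a" "snd a" "fst b" "snd b"] c'M False by (cases a; cases b) auto
  moreover have "a = troot T \<and> b = troot T' \<or>
      (\<exists>d d'. (d, d') \<in> insert (c, c') M \<and> a \<in> descendants T d \<and> b \<in> descendants T' d')"
    if "(a, b) \<in> P" for a b
    using P[OF that] by blast
  ultimately have "glued k T T' n P (insert (c, c') M)"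
    using gluedD(8)[OF g] M EVM bf c c'(1,2) gluedD(1)[OF g]
    by (intro gluedI) (assumption | auto simp: j_def)+
  moreover have "card (insert (c, c') M) \<le> Suc (card M)"
    by (rule card_insert_le_m1) auto
  ultimately show ?thesis by blast
qed

text \<open>The answer comes from the subgame at \<open>(c, c')\<close>. By disjointness
  \<open>v\<close> lies below no other matched child, so the other positions stay as they are and
  merely give up one of their moves.\<close>

lemma glued_move:
  assumes T: "rooted_tree T" "rooted_tree T'" and g: "glued k T T' (Suc n) P M"
    and c: "(c, c') \<in> M" and v: "v \<in> descendants T c"
  shows "\<exists>v'\<in>descendants T' c'. glued k T T' n (insert (v, v') P) M"
proof -
  let ?Q = "\<lambda>P c c'. insert (c, c') (P \<inter> (descendants T c \<times> descendants T' c'))"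
  note M = gluedD(5,6,8)[OF g]
  obtain v' where v': "v' \<in> descendants T' c'"
    "back_forth n (subtree T c) (subtree T' c') (insert (v, v') (?Q P c c'))"
    using M(3)[OF c] v by auto
  have "back_forth n (subtree T d) (subtree T' d') (?Q (insert (v, v') P) d d')"
    if d: "(d, d') \<in> M" for d d'
  proof (cases "d = c")
    case True
    then have "d' = c'" using gluedD(4)[OF g c d] by simp
    have "?Q (insert (v, v') P) c c' = insert (v, v') (?Q P c c')" using v v' by auto
    then show ?thesis using v'(2) True \<open>d' = c'\<close> by simp
  next
    case False
    then have "v \<notin> descendants T d"
      using descendants_disjoint[OF T(1) M(1)[OF c] M(1)[OF d] v] by blast
    then have "?Q (insert (v, v') P) d d' = ?Q P d d'" by auto
    then show ?thesis using back_forth_Suc[OF M(3)[OF d]] by simp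
  qed
  moreover have "fst a = fst b \<longleftrightarrow> snd a = snd b" if "a \<in> M" "b \<in> M" for a b
    using gluedD(4)[OF g, of "fst a" "snd a" "fst b" "snd b"] that by simp
  moreover have "a = troot T \<and> b = troot T' \<or>
      (\<exists>d d'. (d, d') \<in> M \<and> a \<in> descendants T d \<and> b \<in> descendants T' d')"
    if "(a, b) \<in> insert (v, v') P" for a b
    using that gluedD(9)[OF g, of a b] c v v'(1) by blast
  ultimately have "glued k T T' n (insert (v, v') P) M"
    using gluedD(1,2,3,7)[OF g] by (intro gluedI) (assumption | blast)+
  then show ?thesis using v'(1) by blast
qed

text \<open>The budget \<open>card M + n\<close> never grows: a move lowers the number of remaining
  moves by one and adds at most one match. The match is added before the move, with all
  \<open>Suc n\<close> moves still available in the new subgame.\<close>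

lemma glued_forth:
  assumes T: "rooted_tree T" "rooted_tree T'" and tal: "child_tallies k T = child_tallies k T'"
    and g: "glued k T T' (Suc n) P M" and n: "card M + Suc n \<le> k" and v: "v \<in> verts T"
  shows "\<exists>v'\<in>verts T'. \<exists>M'. glued k T T' n (insert (v, v') P) M' \<and> card M' + n \<le> k"
  using T(1) v
proof (cases rule: vertex_cases)
  case 1
  \<comment> \<open>Playing the root repeats a pair that is already present and uses no
    rootchild.\<close>
  have "insert (troot T, troot T') P = P" using gluedD(1)[OF g] by blast
  then show ?thesis
    using 1 glued_Suc[OF g] n T(2) by (intro bexI[of _ "troot T'"] exI[of _ M])
      (auto simp: rooted_tree_def)
next
  case (2 c)
  obtain M' c' where M': "glued k T T' (Suc n) P M'" "(c, c') \<in> M'" "card M' \<le> Suc (card M)"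
    using glued_extend_match[OF T tal g _ _ 2(1)] n by auto
  obtain v' where "v' \<in> descendants T' c'" "glued k T T' n (insert (v, v') P) M'"
    using glued_move[OF T M'(1,2) 2(2)] by blast
  then show ?thesis using M'(3) n by (intro bexI[of _ v'] exI[of _ M']) (auto simp: descendants_def)
qed

lemma glued_back_forth:
  assumes T: "rooted_tree T" "rooted_tree T'" and tal: "child_tallies k T = child_tallies k T'"
  shows "glued k T T' n P M \<Longrightarrow> card M + n \<le> k \<Longrightarrow> back_forth n T T' P"
proof (induction n arbitrary: P M)
  case 0
  then show ?case using glued_partial_iso[OF T] by simp
next
  case (Suc n)
  have "\<exists>v'\<in>verts T'. back_forth n T T' (insert (v, v') P)" if "v \<in> verts T" for v
    using glued_forth[OF T tal Suc.prems that] Suc.IH by blast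
  moreover have "\<exists>v\<in>verts T. back_forth n T T' (insert (v, v') P)" if v': "v' \<in> verts T'" for v'
  proof -
    have "card (M\<inverse>) + Suc n \<le> k" using Suc.prems(2) by (simp add: card_inverse)
    then obtain v M' where v: "v \<in> verts T" "glued k T' T n (insert (v', v) (P\<inverse>)) M'" "card M' + n \<le> k"
      using glued_forth[OF T(2,1) tal[symmetric] glued_converse[OF Suc.prems(1)] _ v'] by blast
    have "insert (v', v) (P\<inverse>) = (insert (v, v') P)\<inverse>" by auto
    then have "glued k T T' n (insert (v, v') P) (M'\<inverse>)"
      using glued_converse[OF v(2)] by simp
    then show ?thesis using Suc.IH[of "insert (v, v') P" "M'\<inverse>"] v by (auto simp: card_inverse)
  qed
  ultimately show ?case using glued_partial_iso[OF T Suc.prems(1)] by simp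
qed

text \<open>This is what makes the description in \<open>Gam\<close> unique. The game starts with
  nothing matched and all \<open>k\<close> moves in the budget.\<close>

lemma EV_eq_if_child_tallies_eq:
  assumes T: "rooted_tree T" "rooted_tree T'" and tal: "child_tallies k T = child_tallies k T'"
  shows "EV k T = EV k T'"
proof -
  have "glued k T T' k {(troot T, troot T')} {}" by (simp add: glued_def)
  then have "back_forth k T T' {(troot T, troot T')}"
    by (rule glued_back_forth[OF assms]) simp
  then show ?thesis using EV_eq_iff[OF T] by (simp add: equiv_upto_iff_back_forth)
qed

lemma Gam_child_tallies:
  fixes T :: ctree
  assumes "rooted_tree T"
  shows "Gam k (child_tallies k T) = EV k T"
  unfolding Gam_def using assms EV_eq_if_child_tallies_eq by (intro the_equality) blast+

section \<open>The Galton-Watson tree\<close>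

text \<open>Vertices are generated by appending a letter at the end, while branches are split off by
  the first letter; this translates between the two.\<close>

lemma gw_verts_Cons_iff: "i # u \<in> gw_verts \<omega> \<longleftrightarrow> i < \<omega> [] \<and> u \<in> gw_verts (\<lambda>v. \<omega> (i # v))"
proof (induction u rule: rev_induct)
  case Nil
  show ?case using gw_verts_snoc_iff[of "[]" i \<omega>] by (simp add: gw_root)
next
  case (snoc x u)
  have "i # u @ [x] \<in> gw_verts \<omega> \<longleftrightarrow> i # u \<in> gw_verts \<omega> \<and> x < \<omega> (i # u)"
    using gw_verts_snoc_iff[of "i # u" x \<omega>] by simp
  then show ?case using snoc by (auto simp: gw_verts_snoc_iff)
qed

lemma rootchildren_gw_tree: "rootchildren (gw_tree \<omega>) = (\<lambda>i. [i]) ` {..<\<omega> []}"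
  by (auto simp: rootchildren_def gw_tree_def gw_root)

lemma verts_gw_tree: "verts (gw_tree \<omega>) = gw_verts \<omega>"
  by (simp add: gw_tree_def)

lemma par_gw_tree_rtrancl:
  assumes "u \<in> gw_verts \<omega>"
  shows "(u, v) \<in> (par (gw_tree \<omega>))\<^sup>* \<longleftrightarrow> (\<exists>w. u = v @ w)"
proof
  assume "(u, v) \<in> (par (gw_tree \<omega>))\<^sup>*"
  then show "\<exists>w. u = v @ w"
    by induction (auto simp: gw_tree_def)
next
  assume "\<exists>w. u = v @ w"
  then obtain w where "u = v @ w" by blast
  with assms show "(u, v) \<in> (par (gw_tree \<omega>))\<^sup>*"
  proof (induction w arbitrary: u rule: rev_induct)
    case (snoc x w)
    then have "v @ w \<in> gw_verts \<omega>" "x < \<omega> (v @ w)"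
      using gw_verts_snoc_iff[of "v @ w" x \<omega>] by simp_all
    then have "(u, v @ w) \<in> par (gw_tree \<omega>)" using snoc.prems by (auto simp: gw_tree_def)
    then show ?case
      using snoc.IH[OF \<open>v @ w \<in> gw_verts \<omega>\<close> refl] by (rule converse_rtrancl_into_rtrancl)
  qed simp
qed

lemma subtree_gw_tree:
  assumes "i < \<omega> []"
  shows "subtree (gw_tree \<omega>) [i] = map_rtree (Cons i) (gw_tree (\<lambda>u. \<omega> (i # u)))"
proof -
  let ?\<omega> = "\<lambda>u. \<omega> (i # u)"
  have D: "descendants (gw_tree \<omega>) [i] = Cons i ` gw_verts ?\<omega>"
  proof -
    have "descendants (gw_tree \<omega>) [i] = {v \<in> gw_verts \<omega>. \<exists>w. v = i # w}"
      by (auto simp: descendants_def verts_gw_tree par_gw_tree_rtrancl)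
    also have "\<dots> = Cons i ` gw_verts ?\<omega>"
      using assms by (auto simp: gw_verts_Cons_iff)
    finally show ?thesis .
  qed
  have "par (gw_tree \<omega>) \<inter> (Cons i ` gw_verts ?\<omega> \<times> Cons i ` gw_verts ?\<omega>)
      = map_prod (Cons i) (Cons i) ` par (gw_tree ?\<omega>)" (is "?L = ?R")
  proof (intro set_eqI iffI)
    fix p assume "p \<in> ?L"
    then obtain u x w v where "p = (u @ [x], u)" "x < \<omega> u" "u @ [x] = i # w" "w \<in> gw_verts ?\<omega>"
      "u = i # v" "v \<in> gw_verts ?\<omega>"
      by (auto simp: gw_tree_def)
    then have "p = map_prod (Cons i) (Cons i) (v @ [x], v)" "(v @ [x], v) \<in> par (gw_tree ?\<omega>)"
      by (auto simp: gw_tree_def)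
    then show "p \<in> ?R" by blast
  next
    fix p assume "p \<in> ?R"
    then obtain v x where p: "p = ((i # v) @ [x], i # v)" "v \<in> gw_verts ?\<omega>" "x < ?\<omega> v"
      by (auto simp: gw_tree_def)
    then have "v @ [x] \<in> gw_verts ?\<omega>" by (simp add: gw_verts_snoc_iff)
    moreover have "p \<in> par (gw_tree \<omega>)"
      unfolding gw_tree_def using p assms by (force simp: gw_verts_Cons_iff)
    ultimately show "p \<in> ?L" using p by auto
  qed
  then show ?thesis
    using D by (simp add: subtree_def map_rtree_def) (simp add: gw_tree_def)
qed

text \<open>Meaningful for every \<open>i\<close>, also when \<open>[i]\<close> is not a vertex. The
  value depends on the coordinates \<open>i # u\<close> only, hence not on the root count
  \<open>\<omega> []\<close>.\<close>

definition branch_class :: "nat \<Rightarrow> nat \<Rightarrow> (nat list \<Rightarrow> nat) \<Rightarrow> eclass" where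
  "branch_class k i \<omega> = EV k (gw_tree (\<lambda>u. \<omega> (i # u)))"

lemma EV_subtree_gw_tree:
  assumes "i < \<omega> []"
  shows "EV k (subtree (gw_tree \<omega>) [i]) = branch_class k i \<omega>"
  unfolding subtree_gw_tree[where i = i and \<omega> = \<omega>, OF assms] branch_class_def
  by (simp add: EV_def equiv_upto_def models_map_rtree[OF rooted_tree_gw_tree])

definition tally_class :: "nat \<Rightarrow> nat \<Rightarrow> (nat \<Rightarrow> eclass) \<Rightarrow> eclass" where
  "tally_class k N l = Gam k (\<lambda>j \<in> Sig k. tally_of k {i \<in> {..<N}. l i = j})"

lemma tally_class_cong: "(\<And>i. i < N \<Longrightarrow> l i = l' i) \<Longrightarrow> tally_class k N l = tally_class k N l'"
proof -
  assume "\<And>i. i < N \<Longrightarrow> l i = l' i"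
  then have "{i \<in> {..<N}. l i = j} = {i \<in> {..<N}. l' i = j}" for j by auto
  then show ?thesis by (simp only: tally_class_def)
qed

text \<open>The fixed point equation in pointwise form, before any probability enters.\<close>

lemma EV_gw_tree: "EV k (gw_tree \<omega>) = tally_class k (\<omega> []) (\<lambda>i. branch_class k i \<omega>)"
proof -
  have "{v \<in> rootchildren (gw_tree \<omega>). EV k (subtree (gw_tree \<omega>) v) = j}
      = (\<lambda>i. [i]) ` {i \<in> {..<\<omega> []}. branch_class k i \<omega> = j}" for j
    using EV_subtree_gw_tree[of _ \<omega> k] by (auto simp: rootchildren_gw_tree)
  moreover have "tally_of k ((\<lambda>i. [i]) ` A) = tally_of k A" for A :: "nat set"
    by (simp add: tally_of_def finite_image_iff card_image inj_on_def)
  ultimately have "child_tallies k (gw_tree \<omega>)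
      = (\<lambda>j \<in> Sig k. tally_of k {i \<in> {..<\<omega> []}. branch_class k i \<omega> = j})"
    by (simp only: child_tallies_def)
  then show ?thesis
    using Gam_child_tallies[OF rooted_tree_gw_tree, of k \<omega>] by (simp add: tally_class_def)
qed

section \<open>The product measure and its self-similarity\<close>

interpretation GW: prob_space "GW c" for c
  unfolding GW_def by (intro prob_space_PiM measure_pmf.prob_space_axioms)

lemma space_GW [simp]: "space (GW c) = UNIV"
  by (simp add: GW_def space_PiM PiE_def)

lemma EV_gw_tree_in_Sig: "EV k (gw_tree \<omega>) \<in> Sig k"
  by (intro EV_in_Sig rooted_tree_gw_tree)

lemma GW_component_measurable: "(\<lambda>\<omega>. \<omega> u) \<in> GW c \<rightarrow>\<^sub>M measure_pmf (poisson_pmf c)"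
  unfolding GW_def by (rule measurable_component_singleton) simp

lemma distr_GW_component:
  "distr (GW c) (measure_pmf (poisson_pmf c)) (\<lambda>\<omega>. \<omega> u) = measure_pmf (poisson_pmf c)"
  using distr_PiM_component[of UNIV "\<lambda>_. measure_pmf (poisson_pmf c)" u]
  by (simp add: GW_def measure_pmf.prob_space_axioms)

lemma GW_component_event: "{\<omega>. \<omega> u = N} \<in> GW.events c"
  using measurable_sets[OF GW_component_measurable[of u c], of "{N}"] by (simp add: vimage_def)

lemma GW_shift_measurable: "(\<lambda>\<omega> u. \<omega> (i # u)) \<in> GW c \<rightarrow>\<^sub>M GW c"
  unfolding GW_def by (intro measurable_PiM_single') (auto simp: space_PiM PiE_def)

text \<open>All factors of the product are equal, so selecting the coordinates along the injection
  \<open>Cons i\<close> reproduces the same product: each branch is a copy of the whole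
  tree.\<close>

lemma distr_GW_shift: "distr (GW c) (GW c) (\<lambda>\<omega> u. \<omega> (i # u)) = GW c"
  using distr_PiM_reindex[of UNIV "\<lambda>_. measure_pmf (poisson_pmf c)" "Cons i" UNIV]
  by (simp add: GW_def restrict_UNIV measure_pmf.prob_space_axioms)

lemma prob_branch_class:
  assumes "j \<in> Sig k"
  shows "GW.prob c {\<omega>. branch_class k i \<omega> = j} = gw_class_probs k c j"
proof -
  have "GW.prob c {\<omega>. EV k (gw_tree \<omega>) = j}
      = measure (distr (GW c) (GW c) (\<lambda>\<omega> u. \<omega> (i # u))) {\<omega>. EV k (gw_tree \<omega>) = j}"
    by (simp add: distr_GW_shift)
  also have "\<dots> = GW.prob c {\<omega>. branch_class k i \<omega> = j}"
    using gw_class_event_measurable[OF assms, of c]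
    by (subst measure_distr[OF GW_shift_measurable]) (simp_all add: vimage_def branch_class_def)
  finally show ?thesis using assms by (simp add: gw_class_probs_def)
qed

lemma sum_prob_class: "(\<Sum>j\<in>Sig k. GW.prob c {\<omega>. EV k (gw_tree \<omega>) = j}) = 1"
proof -
  have "(\<Sum>j\<in>Sig k. GW.prob c {\<omega>. EV k (gw_tree \<omega>) = j})
      = GW.prob c (\<Union>j\<in>Sig k. {\<omega>. EV k (gw_tree \<omega>) = j})"
    using finite_Sig gw_class_event_measurable[of _ k c]
    by (intro GW.finite_measure_finite_Union[symmetric]) (auto simp: disjoint_family_on_def)
  also have "(\<Union>j\<in>Sig k. {\<omega>. EV k (gw_tree \<omega>) = j}) = space (GW c)"
    using EV_gw_tree_in_Sig by auto
  finally show ?thesis using GW.prob_space[of c] by simp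
qed

lemma gw_class_probs_Distr: "gw_class_probs k c \<in> Distr k"
  using sum_prob_class[of c k] by (simp add: Distr_def gw_class_probs_def)

section \<open>Independent random labels\<close>

lemma pmf_label_pmf:
  assumes "x \<in> Distr k"
  shows "pmf (label_pmf k x) j = (if j \<in> Sig k then x j else 0)"
  unfolding label_pmf_def
proof (rule pmf_embed_pmf)
  let ?f = "\<lambda>j. if j \<in> Sig k then x j else 0"
  show "0 \<le> ?f j" for j using assms by (simp add: Distr_def)
  have "(\<integral>\<^sup>+ j. ennreal (?f j) \<partial>count_space UNIV) = (\<Sum>j\<in>Sig k. ennreal (?f j))"
    using finite_Sig by (intro nn_integral_count_space') auto
  also have "\<dots> = ennreal (\<Sum>j\<in>Sig k. ?f j)"
    using assms by (intro sum_ennreal) (simp add: Distr_def)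
  finally show "(\<integral>\<^sup>+ j. ennreal (?f j) \<partial>count_space UNIV) = 1"
    using assms by (simp add: Distr_def)
qed

text \<open>Labellings drawn from \<open>Pi_pmf\<close> equal \<open>dflt\<close> outside
  \<open>A\<close>, those summed over are \<open>undefined\<close> there; \<open>?g\<close> passes
  between the two, which \<open>Q\<close> cannot notice. The event \<open>{l. Q l}\<close> may be
  infinite, so it is first replaced, up to a null set, by a finite image of
  \<open>?g\<close>.\<close>

lemma measure_Pi_pmf_eq_sum:
  assumes "finite A" "finite S" "set_pmf p \<subseteq> S" and Q: "\<And>l l'. (\<And>i. i \<in> A \<Longrightarrow> l i = l' i) \<Longrightarrow> Q l = Q l'"
  shows "measure_pmf.prob (Pi_pmf A dflt (\<lambda>_. p)) {l. Q l}
       = (\<Sum>l \<in> {l \<in> A \<rightarrow>\<^sub>E S. Q l}. \<Prod>i\<in>A. pmf p (l i))"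
proof -
  let ?g = "\<lambda>l i. if i \<in> A then l i else dflt"
  have fin: "finite {l \<in> A \<rightarrow>\<^sub>E S. Q l}" using assms(1,2) by (simp add: finite_PiE)
  have "measure_pmf.prob (Pi_pmf A dflt (\<lambda>_. p)) {l. Q l}
      = measure_pmf.prob (Pi_pmf A dflt (\<lambda>_. p)) (?g ` {l \<in> A \<rightarrow>\<^sub>E S. Q l})"
  proof (rule measure_pmf.finite_measure_eq_AE)
    have "l \<in> {l. Q l} \<longleftrightarrow> l \<in> ?g ` {l \<in> A \<rightarrow>\<^sub>E S. Q l}"
      if "l \<in> set_pmf (Pi_pmf A dflt (\<lambda>_. p))" for l
    proof
      have l: "\<And>i. i \<in> A \<Longrightarrow> l i \<in> S" "\<And>i. i \<notin> A \<Longrightarrow> l i = dflt"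
        using that assms(1,3) by (auto simp: set_Pi_pmf PiE_dflt_def)
      assume "l \<in> {l. Q l}"
      then have "restrict l A \<in> {l \<in> A \<rightarrow>\<^sub>E S. Q l}" using l Q[of "restrict l A" l] by auto
      moreover have "l = ?g (restrict l A)" using l by auto
      ultimately show "l \<in> ?g ` {l \<in> A \<rightarrow>\<^sub>E S. Q l}" by blast
    next
      assume "l \<in> ?g ` {l \<in> A \<rightarrow>\<^sub>E S. Q l}"
      then obtain l' where "Q l'" "l = ?g l'" by blast
      then show "l \<in> {l. Q l}" using Q[of l l'] by simp
    qed
    then show "AE l in measure_pmf (Pi_pmf A dflt (\<lambda>_. p)).
        l \<in> {l. Q l} \<longleftrightarrow> l \<in> ?g ` {l \<in> A \<rightarrow>\<^sub>E S. Q l}"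
      by (simp add: AE_measure_pmf_iff)
  qed auto
  also have "\<dots> = (\<Sum>l\<in>?g ` {l \<in> A \<rightarrow>\<^sub>E S. Q l}. pmf (Pi_pmf A dflt (\<lambda>_. p)) l)"
    using fin by (intro measure_measure_pmf_finite) simp
  also have "\<dots> = (\<Sum>l\<in>{l \<in> A \<rightarrow>\<^sub>E S. Q l}. pmf (Pi_pmf A dflt (\<lambda>_. p)) (?g l))"
  proof (rule sum.reindex_cong[OF _ refl refl])
    show "inj_on ?g {l \<in> A \<rightarrow>\<^sub>E S. Q l}"
    proof (rule inj_onI)
      fix l l' assume "l \<in> {l \<in> A \<rightarrow>\<^sub>E S. Q l}" "l' \<in> {l \<in> A \<rightarrow>\<^sub>E S. Q l}" and eq: "?g l = ?g l'"
      then have "l \<in> A \<rightarrow>\<^sub>E S" "l' \<in> A \<rightarrow>\<^sub>E S" by auto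
      moreover have "l i = l' i" if "i \<in> A" for i using fun_cong[OF eq, of i] that by simp
      ultimately show "l = l'" by (rule PiE_ext)
    qed
  qed
  also have "\<dots> = (\<Sum>l\<in>{l \<in> A \<rightarrow>\<^sub>E S. Q l}. \<Prod>i\<in>A. pmf p (l i))"
    using assms(1) by (intro sum.cong refl) (simp add: pmf_Pi')
  finally show ?thesis .
qed

section \<open>Independence of the root count and the branches\<close>

lemma prob_branches:
  assumes "\<And>i. i < N \<Longrightarrow> l i \<in> Sig k"
  shows "GW.prob c {\<omega>. \<omega> [] = N \<and> (\<forall>i<N. branch_class k i \<omega> = l i)}
       = pmf (poisson_pmf c) N * (\<Prod>i<N. gw_class_probs k c (l i))"
proof -
  let ?M = "\<lambda>_::nat list. measure_pmf (poisson_pmf c)"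
  \<comment> \<open>\<open>None\<close> stands for the root count and \<open>Some i\<close> for
    branch \<open>i\<close>; \<open>K\<close> gives the words each of them reads, and these blocks
    are pairwise disjoint.\<close>
  define K where "K a = (case a of None \<Rightarrow> {[]} | Some i \<Rightarrow> range (Cons i))" for a :: "nat option"
  define Y where "Y a \<omega> = (case a of None \<Rightarrow> \<omega> [] = N | Some i \<Rightarrow> EV k (gw_tree (\<lambda>u. \<omega> (i # u))) = l i)"
    for a :: "nat option" and \<omega> :: "nat list \<Rightarrow> nat"
  let ?L = "insert None (Some ` {..<N})"
  \<comment> \<open>Criterion for independent coordinates: their joint law is the product of the
    marginals. Here the joint law is \<open>GW c\<close> itself.\<close>
  have "distr (GW c) (PiM UNIV ?M) (\<lambda>\<omega>. \<lambda>u\<in>UNIV. \<omega> u) = (\<Pi>\<^sub>M u\<in>UNIV. distr (GW c) (?M u) (\<lambda>\<omega>. \<omega> u))"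
    unfolding distr_GW_component restrict_UNIV GW_def[symmetric] by (rule distr_id)
  then have "prob_space.indep_vars (GW c) ?M (\<lambda>u \<omega>. \<omega> u) UNIV"
    by (intro prob_space.indep_vars_iff_distr_eq_PiM[OF GW.prob_space_axioms, THEN iffD2])
      (rule GW_component_measurable | assumption | simp)+
  then have "prob_space.indep_vars (GW c) (\<lambda>a. PiM (K a) ?M) (\<lambda>a \<omega>. restrict (\<lambda>u. \<omega> u) (K a)) ?L"
    by (rule GW.indep_vars_restrict) (auto simp: K_def disjoint_family_on_def)
  moreover have "Y a \<in> PiM (K a) ?M \<rightarrow>\<^sub>M count_space UNIV" if "a \<in> ?L" for a
  proof (cases a)
    case None
    have "(\<lambda>\<omega>. \<omega> []) \<in> PiM {[]} ?M \<rightarrow>\<^sub>M measure_pmf (poisson_pmf c)"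
      by (rule measurable_component_singleton) simp
    then have "(\<lambda>\<omega>. \<omega> []) \<in> PiM {[]} ?M \<rightarrow>\<^sub>M count_space UNIV" by simp
    from measurable_compose[OF this, of "\<lambda>n. n = N" "count_space UNIV"]
    show ?thesis using None by (simp add: Y_def[abs_def] K_def)
  next
    case (Some i)
    then have i: "l i \<in> Sig k" using that assms by auto
    have "(\<lambda>\<omega> u. \<omega> (i # u)) \<in> PiM (range (Cons i)) ?M \<rightarrow>\<^sub>M GW c"
      unfolding GW_def by (intro measurable_PiM_single') (auto simp: space_PiM PiE_def)
    moreover have "Measurable.pred (GW c) (\<lambda>\<omega>. EV k (gw_tree \<omega>) = l i)"
      using gw_class_event_measurable[OF i, of c] by (simp add: pred_def)
    ultimately have "(\<lambda>\<omega>. EV k (gw_tree (\<lambda>u. \<omega> (i # u))) = l i)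
        \<in> PiM (range (Cons i)) ?M \<rightarrow>\<^sub>M count_space UNIV"
      by (rule measurable_compose)
    then show ?thesis using Some by (simp add: Y_def[abs_def] K_def)
  qed
  ultimately have ind: "prob_space.indep_vars (GW c) (\<lambda>_. count_space UNIV) (\<lambda>a \<omega>. Y a (restrict (\<lambda>u. \<omega> u) (K a))) ?L"
    by (rule GW.indep_vars_compose2)
  \<comment> \<open>\<open>Y a\<close> reads coordinates in \<open>K a\<close> only, so the
    restriction, which is \<open>undefined\<close> elsewhere, does not alter it.\<close>
  have Y: "Y a (restrict (\<lambda>u. \<omega> u) (K a))
      = (case a of None \<Rightarrow> \<omega> [] = N | Some i \<Rightarrow> branch_class k i \<omega> = l i)" for a \<omega>
    by (simp add: Y_def K_def branch_class_def split: option.split)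
  have "{\<omega>. \<omega> [] = N \<and> (\<forall>i<N. branch_class k i \<omega> = l i)}
      = (\<Inter>a\<in>?L. (\<lambda>\<omega>. Y a (restrict (\<lambda>u. \<omega> u) (K a))) -` {True} \<inter> space (GW c))"
    by (auto simp: Y)
  then have "GW.prob c {\<omega>. \<omega> [] = N \<and> (\<forall>i<N. branch_class k i \<omega> = l i)}
      = (\<Prod>a\<in>?L. GW.prob c ((\<lambda>\<omega>. Y a (restrict (\<lambda>u. \<omega> u) (K a))) -` {True} \<inter> space (GW c)))"
    using GW.indep_varsD_finite[OF ind, of "\<lambda>_. {True}"] by simp
  also have "\<dots> = GW.prob c {\<omega>. \<omega> [] = N} * (\<Prod>i<N. GW.prob c {\<omega>. branch_class k i \<omega> = l i})"
    by (simp add: Y vimage_def prod.reindex)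
  also have "(\<Prod>i<N. GW.prob c {\<omega>. branch_class k i \<omega> = l i}) = (\<Prod>i<N. gw_class_probs k c (l i))"
    using assms by (intro prod.cong refl prob_branch_class) auto
  also have "GW.prob c {\<omega>. \<omega> [] = N} = pmf (poisson_pmf c) N"
  proof -
    have "pmf (poisson_pmf c) N = measure (distr (GW c) (?M []) (\<lambda>\<omega>. \<omega> [])) {N}"
      by (simp add: distr_GW_component measure_pmf_single)
    also have "\<dots> = GW.prob c {\<omega>. \<omega> [] = N}"
      by (subst measure_distr[OF GW_component_measurable]) (simp_all add: vimage_def)
    finally show ?thesis ..
  qed
  finally show ?thesis .
qed

text \<open>The product formula is available once all \<open>N\<close> branch classes are
  prescribed, so the event is split into finitely many disjoint pieces, one for each label vector
  giving \<open>j\<close>. The resulting sum of products is the probability of the same condition on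
  independent labels.\<close>

lemma prob_class_given_root:
  "GW.prob c {\<omega>. \<omega> [] = N \<and> EV k (gw_tree \<omega>) = j} = pmf (poisson_pmf c) N *
     measure_pmf.prob (Pi_pmf {..<N} undefined (\<lambda>_. label_pmf k (gw_class_probs k c)))
       {l. tally_class k N l = j}"
proof -
  let ?p = "label_pmf k (gw_class_probs k c)"
  let ?E = "{l \<in> {..<N} \<rightarrow>\<^sub>E Sig k. tally_class k N l = j}"
  let ?B = "\<lambda>l. {\<omega>. \<omega> [] = N \<and> (\<forall>i<N. branch_class k i \<omega> = l i)}"
  have p: "pmf ?p s = (if s \<in> Sig k then gw_class_probs k c s else 0)" for s
    by (rule pmf_label_pmf[OF gw_class_probs_Distr])
  have fin: "finite ?E" using finite_Sig by (simp add: finite_PiE)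
  have branch: "branch_class k i \<omega> \<in> Sig k" for i \<omega>
    unfolding branch_class_def by (rule EV_gw_tree_in_Sig)
  have "{\<omega>. \<omega> [] = N \<and> EV k (gw_tree \<omega>) = j} = (\<Union>l\<in>?E. ?B l)" (is "?U = ?V")
  proof (intro set_eqI iffI)
    fix \<omega> assume \<omega>: "\<omega> \<in> ?U"
    let ?l = "restrict (\<lambda>i. branch_class k i \<omega>) {..<N}"
    have "tally_class k N ?l = j"
      using \<omega> tally_class_cong[of N ?l "\<lambda>i. branch_class k i \<omega>" k] by (auto simp: EV_gw_tree)
    then have "?l \<in> ?E" "\<omega> \<in> ?B ?l" using \<omega> branch by auto
    then show "\<omega> \<in> ?V" by blast
  next
    fix \<omega> assume "\<omega> \<in> ?V"
    then obtain l where "tally_class k N l = j" "\<omega> [] = N" "\<And>i. i < N \<Longrightarrow> branch_class k i \<omega> = l i"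
      by blast
    then show "\<omega> \<in> ?U"
      using tally_class_cong[of N "\<lambda>i. branch_class k i \<omega>" l k] by (simp add: EV_gw_tree)
  qed
  moreover have "?B l \<in> GW.events c" if "l \<in> ?E" for l
  proof -
    have "Measurable.pred (GW c) (\<lambda>\<omega>. \<omega> [] = N)"
      using GW_component_event[of "[]" N c] by (simp add: pred_def)
    moreover have "Measurable.pred (GW c) (\<lambda>\<omega>. branch_class k i \<omega> = l i)" if "i < N" for i
    proof -
      have "l i \<in> Sig k" using \<open>l \<in> ?E\<close> that by auto
      then have "Measurable.pred (GW c) (\<lambda>\<omega>. EV k (gw_tree \<omega>) = l i)"
        using gw_class_event_measurable[of "l i" k c] by (simp add: pred_def)
      from measurable_compose[OF GW_shift_measurable this] show ?thesis
        by (simp add: branch_class_def)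
    qed
    ultimately have "Measurable.pred (GW c) (\<lambda>\<omega>. \<omega> [] = N \<and> (\<forall>i\<in>{..<N}. branch_class k i \<omega> = l i))"
      by (intro pred_intros_logic pred_intros_finite) auto
    then show ?thesis by (simp add: pred_def Ball_def)
  qed
  moreover have "disjoint_family_on ?B ?E"
    unfolding disjoint_family_on_def
  proof (intro ballI impI equals0I)
    fix l l' \<omega>
    assume l: "l \<in> ?E" "l' \<in> ?E" "l \<noteq> l'" and \<omega>: "\<omega> \<in> ?B l \<inter> ?B l'"
    have "l i = l' i" if "i \<in> {..<N}" for i using \<omega> that by auto
    then have "l = l'" using l by (intro PiE_ext[of l "{..<N}" "\<lambda>_. Sig k" l']) auto
    with l show False by simp
  qed
  ultimately have "GW.prob c {\<omega>. \<omega> [] = N \<and> EV k (gw_tree \<omega>) = j} = (\<Sum>l\<in>?E. GW.prob c (?B l))"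
    using fin by (simp only:) (intro GW.finite_measure_finite_Union, auto)
  also have "\<dots> = (\<Sum>l\<in>?E. pmf (poisson_pmf c) N * (\<Prod>i<N. pmf ?p (l i)))"
  proof (intro sum.cong refl)
    fix l assume "l \<in> ?E"
    then have "\<And>i. i < N \<Longrightarrow> l i \<in> Sig k" by auto
    then show "GW.prob c (?B l) = pmf (poisson_pmf c) N * (\<Prod>i<N. pmf ?p (l i))"
      by (simp add: prob_branches p)
  qed
  also have "\<dots> = pmf (poisson_pmf c) N * (\<Sum>l\<in>?E. \<Prod>i<N. pmf ?p (l i))"
    by (simp only: sum_distrib_left)
  also have "(\<Sum>l\<in>?E. \<Prod>i<N. pmf ?p (l i))
      = measure_pmf.prob (Pi_pmf {..<N} undefined (\<lambda>_. ?p)) {l. tally_class k N l = j}"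
  proof (rule measure_Pi_pmf_eq_sum[symmetric])
    show "set_pmf ?p \<subseteq> Sig k" by (auto simp: set_pmf_eq p)
    show "(tally_class k N l = j) = (tally_class k N l' = j)"
      if "\<And>i. i \<in> {..<N} \<Longrightarrow> l i = l' i" for l l'
      using tally_class_cong[of N l l' k] that by simp
  qed (use finite_Sig in auto)
  finally show ?thesis .
qed

text \<open>Both sides are averages over the number \<open>N\<close> of rootchildren: on the left by
  the definition of the monadic bind, on the right by countable additivity over the events
  \<open>?A N\<close>.\<close>

lemma pmf_Psi_pmf:
  assumes "j \<in> Sig k"
  shows "pmf (Psi_pmf k c (gw_class_probs k c)) j = GW.prob c {\<omega>. EV k (gw_tree \<omega>) = j}"
proof -
  let ?q = "\<lambda>N. Pi_pmf {..<N} undefined (\<lambda>_. label_pmf k (gw_class_probs k c))"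
  let ?E = "{\<omega>. EV k (gw_tree \<omega>) = j}"
  let ?A = "\<lambda>N. {\<omega>. \<omega> [] = N \<and> EV k (gw_tree \<omega>) = j}"
  have E: "?E \<in> GW.events c" using gw_class_event_measurable[OF assms, of c] by simp
  have A: "?A N \<in> GW.events c" for N
    using sets.Int[OF GW_component_event[of "[]" N c] E] by (simp add: Collect_conj_eq)
  have "pmf (Psi_pmf k c (gw_class_probs k c)) j
      = (\<integral>N. measure_pmf.prob (?q N) {l. tally_class k N l = j} \<partial>poisson_pmf c)"
    unfolding Psi_pmf_def tally_class_def[symmetric] map_pmf_def[symmetric] pmf_bind pmf_map
    by (simp add: vimage_def)
  also have "\<dots> = (\<integral>N. pmf (poisson_pmf c) N * measure_pmf.prob (?q N) {l. tally_class k N l = j}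
      \<partial>count_space UNIV)"
    by (subst measure_pmf_eq_density) (simp add: integral_density)
  also have "\<dots> = (\<integral>N. GW.prob c (?A N) \<partial>count_space UNIV)"
    by (simp only: prob_class_given_root)
  also have "\<dots> = GW.prob c ?E"
  proof -
    have sums: "(\<lambda>N. GW.prob c (?A N)) sums GW.prob c (\<Union>N. ?A N)"
      using A by (intro GW.finite_measure_UNION) (auto simp: disjoint_family_on_def)
    \<comment> \<open>The terms are nonnegative, so convergence of the series is absolute, as the
      integral over the counting measure demands.\<close>
    then have "integrable (count_space UNIV) (\<lambda>N. GW.prob c (?A N))"
      by (simp add: integrable_count_space_nat_iff sums_iff)
    then have "(\<integral>N. GW.prob c (?A N) \<partial>count_space UNIV) = (\<Sum>N. GW.prob c (?A N))"
      by (rule integral_count_space_nat)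
    also have "\<dots> = GW.prob c (\<Union>N. ?A N)" using sums by (simp add: sums_iff)
    also have "(\<Union>N. ?A N) = ?E" by auto
    finally show ?thesis .
  qed
  finally show ?thesis .
qed

theorem theorem3p7:
  fixes k :: nat and c :: real
  assumes "k > 0" and "c > 0"
  shows "gw_class_probs k c \<in> Distr k \<and> Psi k c (gw_class_probs k c) = gw_class_probs k c"
proof
  show "gw_class_probs k c \<in> Distr k" by (rule gw_class_probs_Distr)
  show "Psi k c (gw_class_probs k c) = gw_class_probs k c"
  proof
    fix j
    show "Psi k c (gw_class_probs k c) j = gw_class_probs k c j"
    \<comment> \<open>Off \<open>Sig k\<close> both vectors take the value \<open>undefined\<close>,
      so they agree there as functions.\<close>
    proof (cases "j \<in> Sig k")
      case True
      have "Psi k c (gw_class_probs k c) j = GW.prob c {\<omega>. EV k (gw_tree \<omega>) = j}"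
        using True by (simp add: Psi_def pmf_Psi_pmf)
      then show ?thesis using True by (simp add: gw_class_probs_def)
    qed (simp add: Psi_def gw_class_probs_def)
  qed
qed

end
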